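(* Let $p\ge 2$ be arbitrary and let $\{(w_j^k,z_j^k)_{j=0}^{n_k}\}_{k=1}^K$ be the iterates generated by the Multistage Stochastic Optimistic Gradient Descent Ascent algorithm (M-OGDA) with parameters $$\alpha_1=\frac{1}{8L},\quad n_1\ge 1,\qquad \alpha_k=\frac{1}{L\,2^{k+3}},\quad n_k=\left\lceil p\,2^{k+3}\kappa\log 2\right\rceil\quad (k\ge 2).$$ Then for every $k\ge 1$ (i.e. $1\le k\le K$), $$\mathbb{E}\big[\|w_{n_k}^k-z^*\|^2\big]\le \frac{\exp\left(-n_1/(8\kappa)\right)}{2^{p(k-1)}}\,\|z_0^0-z^*\|^2+\frac{\sigma^2}{2^{k-1}L\mu}.$$
   Context: Objective. $f:\mathbb{R}^m\times\mathbb{R}^n\to\mathbb{R}$ is continuously differentiable. A convex function $\phi$ is called $\ell$-smooth if $\|\nabla\phi(u)-\nabla\phi(v)\|\le \ell\|u-v\|$ for all $u,v$, and $\nu$-strongly convex if $\phi(u)-\phi(v)-\nabla\phi(v)^\top(u-v)\ge\frac{\nu}{2}\|u-v\|^2$ for all $u,v$; $\phi$ is $\nu$-strongly concave if $-\phi$ is $\nu$-strongly convex. For every $\hat y$, $f(\cdot,\hat y)$ is $L_x$-smooth and $\mu_x$-strongly convex; for every $\hat x$, $f(\hat x,\cdot)$ is $L_y$-smooth and $\mu_y$-strongly concave ($\mu_x,\mu_y>0$). Moreover $\|\nabla_xf(x,y)-\nabla_xf(x,\hat y)\|\le L_{xy}\|y-\hat y\|$ for all $x,y,\hat y$ and $\|\nabla_yf(x,y)-\nabla_yf(\hat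 x,y)\|\le L_{yx}\|x-\hat x\|$ for all $x,\hat x,y$. Set $\mu=\min\{\mu_x,\mu_y\}$, $L=\max\{L_x,L_y,L_{xy},L_{yx}\}$ and $\kappa=L/\mu$. Then $f$ has a unique saddle point $(x^*,y^* )$, i.e. $f(x^*,y)\le f(x^*,y^* )\le f(x,y^* )$ for all $x,y$. Vectors $z,w\in\mathbb{R}^{m+n}$ represent concatenations $(x^\top,y^\top)^\top$, and $z^*=(x^{*\top},y^{*\top})^\top$; norms are Euclidean. Stochastic oracle. At an iterate $z=(x^\top,y^\top)^\top$ one has access to random estimates $\tilde\nabla_xf(x,y)$ (using a random sample $\zeta$) and $\tilde\nabla_yf(x,y)$ (using a random sample $\xi$), where $\zeta,\xi$ are independent of each other and of previous iterates, such that $\mathbb{E}[\tilde\nabla_xf(x,y)\mid(x,y)]=\nabla_xf(x,y)$, $\mathbb{E}[\tilde\nabla_yf(x,y)\mid(x,y)]=\nabla_yf(x,y)$, $\mathbb{E}[\|\tilde\nabla_xf(x,y)-\nabla_xf(x,y)\|^2\mid(x,y)]\le\sigma^2$ and $\mathbb{E}[\|\tilde\nabla_yf(x,y)-\nabla_yf(x,y)\|^2\mid(x,y)]\le\sigma^2$. Define $\tilde\Phi(z)=\begin{bmatrix}\tilde\nabla_xf(x,y)\\-\tilde\nabla_yf(x,y)\end{bmatrix}$. M-OGDA. Input: an initial point $z_0^0$, stepsizes $\{\alpha_k\}_{k=1}^K$, stage lengths $\{n_k\}_{k=1}^K$ (positive integers). Set $n_0=0$ and $w_0^0=z_0^0$.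 For $k=1,\dots,K$: set $z_0^k=z_{n_{k-1}}^{k-1}$, $w_0^k=w_{n_{k-1}}^{k-1}$, and for $j=0,\dots,n_k-1$ set $z_{j+1}^k=w_j^k-\alpha_k\tilde\Phi(z_j^k)$ and $w_{j+1}^k=w_j^k-\alpha_k\tilde\Phi(z_{j+1}^k)$. The stochastic gradient is sampled once per point $z$ of the sequence and then reused: the vector $\tilde\Phi(z_{j+1}^k)$ used to update $w$ is the same random vector as the one used in the next update of $z$ (also across the passage from one stage to the next, where $z_0^{k+1}=z_{n_k}^k$). *)

theory Defs
  imports "HOL-Probability.Probability"
begin

subsection \<open>Objective\<close>

text \<open>
  The space of concatenated vectors is the product type, whose norm is
  \<open>norm (x, y) = sqrt ((norm x)\<^sup>2 + (norm y)\<^sup>2)\<close>, i.e. the Euclidean norm of the concatenation.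
\<close>

definition grad :: "('a::euclidean_space \<Rightarrow> real) \<Rightarrow> 'a \<Rightarrow> 'a" where
  "grad \<phi> u = (THE D. GDERIV \<phi> u :> D)"

definition continuously_differentiable :: "('a::euclidean_space \<Rightarrow> real) \<Rightarrow> bool" where
  "continuously_differentiable f \<longleftrightarrow>
     (\<exists>G. (\<forall>u. GDERIV f u :> G u) \<and> continuous_on UNIV G)"

definition grad_x :: "('a::euclidean_space \<times> 'b::euclidean_space \<Rightarrow> real) \<Rightarrow> 'a \<times> 'b \<Rightarrow> 'a" where
  "grad_x f z = grad (\<lambda>x. f (x, snd z)) (fst z)"

definition grad_y :: "('a::euclidean_space \<times> 'b::euclidean_space \<Rightarrow> real) \<Rightarrow> 'a \<times> 'b \<Rightarrow> 'b" where
  "grad_y f z = grad (\<lambda>y. f (fst z, y)) (snd z)"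

text \<open>
  Convexity is not part of \<open>smooth_fun\<close>: the notion is applied both to the strongly convex
  functions \<open>f(\<cdot>, y)\<close> and to the strongly concave functions \<open>f(x, \<cdot>)\<close>.
\<close>

definition smooth_fun :: "real \<Rightarrow> ('a::euclidean_space \<Rightarrow> real) \<Rightarrow> bool" where
  "smooth_fun l \<phi> \<longleftrightarrow> (\<forall>u v. norm (grad \<phi> u - grad \<phi> v) \<le> l * norm (u - v))"

definition strongly_convex :: "real \<Rightarrow> ('a::euclidean_space \<Rightarrow> real) \<Rightarrow> bool" where
  "strongly_convex \<nu> \<phi> \<longleftrightarrow>
     (\<forall>u v. \<phi> u - \<phi> v - grad \<phi> v \<bullet> (u - v) \<ge> \<nu> / 2 * (norm (u - v))\<^sup>2)"

definition strongly_concave :: "real \<Rightarrow> ('a::euclidean_space \<Rightarrow> real) \<Rightarrow> bool" where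
  "strongly_concave \<nu> \<phi> \<longleftrightarrow> strongly_convex \<nu> (\<lambda>u. - \<phi> u)"

definition saddle_point :: "('a \<times> 'b \<Rightarrow> real) \<Rightarrow> 'a \<times> 'b \<Rightarrow> bool" where
  "saddle_point f z \<longleftrightarrow>
     (\<forall>x y. f (fst z, y) \<le> f z \<and> f z \<le> f (x, snd z))"

subsection \<open>Stochastic oracle\<close>

text \<open>
  Conditional expectation of a random vector, taken coordinatewise. Like \<open>real_cond_exp\<close>, it is
  meaningful for integrable arguments and determined almost everywhere only.
\<close>

definition vec_cond_exp ::
  "'w measure \<Rightarrow> 'w measure \<Rightarrow> ('w \<Rightarrow> 'a::euclidean_space) \<Rightarrow> 'w \<Rightarrow> 'a" where
  "vec_cond_exp M F X \<omega> = (\<Sum>b\<in>Basis. real_cond_exp M F (\<lambda>\<omega>'. X \<omega>' \<bullet> b) \<omega> *\<^sub>R b)"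

text \<open>
  \<open>Gx z s\<close> and \<open>Gy z t\<close> are the estimates of the two partial gradients at \<open>z\<close> computed from the
  samples \<open>s\<close> and \<open>t\<close>.
\<close>

definition stoch_Phi ::
  "('z \<Rightarrow> 's \<Rightarrow> 'a) \<Rightarrow> ('z \<Rightarrow> 't \<Rightarrow> 'b::uminus) \<Rightarrow> 'z \<Rightarrow> 's \<Rightarrow> 't \<Rightarrow> 'a \<times> 'b" where
  "stoch_Phi Gx Gy z s t = (Gx z s, - Gy z t)"

subsection \<open>The multistage algorithm\<close>

text \<open>
  Position of the point \<open>z\<^sub>j\<^sup>k\<close> (\<open>k \<ge> 1\<close>, \<open>j \<le> n\<^sub>k\<close>) in the sequence of all points. The two names
  \<open>z\<^sub>0\<^sup>k\<^sup>+\<^sup>1\<close> and \<open>z\<^sub>j\<^sup>k\<close>, \<open>j = n\<^sub>k\<close>, of one point receive the same position, so that indexing the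
  samples by position draws exactly one sample pair per point.
\<close>

definition point_index :: "(nat \<Rightarrow> nat) \<Rightarrow> nat \<Rightarrow> nat \<Rightarrow> nat" where
  "point_index n k j = (\<Sum>i\<in>{1..<k}. n i) + j"

text \<open>
  \<open>mogda \<alpha> n \<Phi> z\<^sub>0 k j\<close> is the pair \<open>(z\<^sub>j\<^sup>k, w\<^sub>j\<^sup>k)\<close>; \<open>\<Phi> i v\<close> is the stochastic gradient at \<open>v\<close>
  computed from the \<open>i\<close>-th sample pair. Stage \<open>0\<close> consists of the initial point only, so the
  value \<open>n 0\<close> (which is \<open>0\<close> by convention) has no influence.
\<close>

fun mogda ::
  "(nat \<Rightarrow> real) \<Rightarrow> (nat \<Rightarrow> nat) \<Rightarrow> (nat \<Rightarrow> 'z \<Rightarrow> 'z) \<Rightarrow> 'z::real_vector \<Rightarrow> nat \<Rightarrow> nat \<Rightarrow> 'z \<times> 'z"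
where
  "mogda \<alpha> n \<Phi> z\<^sub>0 0 j = (z\<^sub>0, z\<^sub>0)"
| "mogda \<alpha> n \<Phi> z\<^sub>0 (Suc k) 0 = mogda \<alpha> n \<Phi> z\<^sub>0 k (n k)"
| "mogda \<alpha> n \<Phi> z\<^sub>0 (Suc k) (Suc j) =
     (let (z, w) = mogda \<alpha> n \<Phi> z\<^sub>0 (Suc k) j;
          z' = w - \<alpha> (Suc k) *\<^sub>R \<Phi> (point_index n (Suc k) j) z;
          w' = w - \<alpha> (Suc k) *\<^sub>R \<Phi> (point_index n (Suc k) (Suc j)) z'
      in (z', w'))"

text \<open>
  The sigma-algebra of the iterates generated before the \<open>i\<close>-th sample pair is drawn: all points
  \<open>z\<close> up to and including the \<open>i\<close>-th one, at which the pair is going to be used, and all points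
  \<open>w\<close> before the \<open>i\<close>-th one, whose computation involves the pair already.
\<close>

definition past_events ::
  "'w measure \<Rightarrow> nat \<Rightarrow> (nat \<Rightarrow> nat) \<Rightarrow> (nat \<Rightarrow> nat \<Rightarrow> 'w \<Rightarrow> 'z::topological_space) \<Rightarrow>
   (nat \<Rightarrow> nat \<Rightarrow> 'w \<Rightarrow> 'z) \<Rightarrow> nat \<Rightarrow> 'w set set"
where
  "past_events M K n z w i = sigma_sets (space M)
     ({z k j -` A \<inter> space M | k j A.
         1 \<le> k \<and> k \<le> K \<and> j \<le> n k \<and> point_index n k j \<le> i \<and> A \<in> sets borel} \<union>
      {w k j -` A \<inter> space M | k j A.
         1 \<le> k \<and> k \<le> K \<and> j \<le> n k \<and> point_index n k j < i \<and> A \<in> sets borel})"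

end

theory Submission
  imports Defs
begin

text \<open>
  Write \<open>\<Phi> = (\<nabla>\<^sub>x f, - \<nabla>\<^sub>y f)\<close>, which is \<open>2 L\<close>-Lipschitz, strongly monotone with modulus \<open>\<mu>\<close> and
  zero at the saddle point. With \<open>g\<^sub>j\<close> the stochastic gradient at \<open>z\<^sub>j\<close> and \<open>a\<close> the stepsize,
  \<open>w\<^sub>j - z\<^sub>j\<^sub>+\<^sub>1 = a g\<^sub>j\<close> and \<open>w\<^sub>j\<^sub>+\<^sub>1 - z\<^sub>j\<^sub>+\<^sub>1 = a (g\<^sub>j - g\<^sub>j\<^sub>+\<^sub>1)\<close>, so that
  \<open>\<parallel>w\<^sub>j\<^sub>+\<^sub>1 - z\<^sup>*\<parallel>\<^sup>2 = \<parallel>w\<^sub>j - z\<^sup>*\<parallel>\<^sup>2 - 2 a g\<^sub>j\<^sub>+\<^sub>1 \<bullet> (z\<^sub>j\<^sub>+\<^sub>1 - z\<^sup>*) + a\<^sup>2 \<parallel>g\<^sub>j\<^sub>+\<^sub>1 - g\<^sub>j\<parallel>\<^sup>2 - a\<^sup>2 \<parallel>g\<^sub>j\<parallel>\<^sup>2\<close>.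
  The noise of \<open>g\<^sub>j\<^sub>+\<^sub>1\<close> is orthogonal to every square-integrable vector determined by the past,
  in particular to \<open>z\<^sub>j\<^sub>+\<^sub>1 - z\<^sup>*\<close> and to \<open>\<Phi>(z\<^sub>j\<^sub>+\<^sub>1) - g\<^sub>j\<close>. Hence for \<open>a \<le> 1 / (8 L)\<close> the expectation of
  \<open>\<parallel>w - z\<^sup>*\<parallel>\<^sup>2 + \<parallel>w - z\<parallel>\<^sup>2 / 3\<close> contracts by \<open>1 - a \<mu>\<close> in each step up to an error of \<open>8 a\<^sup>2 \<sigma>\<^sup>2\<close>, and
  over a stage the errors add up to at most \<open>8 a \<sigma>\<^sup>2 / \<mu>\<close>. Stage \<open>k \<ge> 2\<close> contracts by
  \<open>2\<^sup>-\<^sup>p \<le> 1 / 4\<close>, and \<open>1 / 4 \<cdot> 2\<^sup>2\<^sup>-\<^sup>k + 2\<^sup>-\<^sup>k = 2\<^sup>1\<^sup>-\<^sup>k\<close>.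
\<close>

subsection \<open>Gradients and the saddle operator\<close>

lemma grad_eqI:
  assumes "GDERIV \<phi> u :> D"
  shows "grad \<phi> u = D"
  unfolding grad_def
proof (rule the_equality)
  fix D' assume "GDERIV \<phi> u :> D'"
  then have "(\<lambda>h. h \<bullet> D') = (\<lambda>h. h \<bullet> D)"
    using assms has_derivative_unique unfolding gderiv_def by blast
  then show "D' = D"
    by (metis inner_commute vector_eq_rdot)
qed (rule assms)

lemma GDERIV_partial_fst:
  assumes "GDERIV f (x, y) :> D"
  shows "GDERIV (\<lambda>x. f (x, y)) x :> fst D"
proof -
  have "((\<lambda>x. f (x, y)) has_derivative (\<lambda>h. (h, 0) \<bullet> D)) (at x)"
    using assms unfolding gderiv_def
    by (rule has_derivative_compose[rotated]) (auto intro!: derivative_eq_intros)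
  then show ?thesis
    by (simp add: gderiv_def inner_prod_def)
qed

lemma GDERIV_partial_snd:
  assumes "GDERIV f (x, y) :> D"
  shows "GDERIV (\<lambda>y. f (x, y)) y :> snd D"
proof -
  have "((\<lambda>y. f (x, y)) has_derivative (\<lambda>h. (0, h) \<bullet> D)) (at y)"
    using assms unfolding gderiv_def
    by (rule has_derivative_compose[rotated]) (auto intro!: derivative_eq_intros)
  then show ?thesis
    by (simp add: gderiv_def inner_prod_def)
qed

lemma grad_zero_at_min:
  assumes "GDERIV \<phi> u :> D" and "\<And>v. \<phi> u \<le> \<phi> v"
  shows "D = 0"
proof -
  have "(\<lambda>h. h \<bullet> D) = (\<lambda>h. 0)"
    using assms has_derivative_local_min[of \<phi> "\<lambda>h. h \<bullet> D" u] by (simp add: gderiv_def)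
  then show ?thesis
    by (metis inner_eq_zero_iff)
qed

text \<open>Adding the inequality for \<open>(u, v)\<close> to the one for \<open>(v, u)\<close>
  cancels the function values and doubles the quadratic term.\<close>

lemma strongly_convex_grad_mono:
  assumes "strongly_convex \<nu> \<phi>"
  shows "\<nu> * (norm (u - v))\<^sup>2 \<le> (grad \<phi> u - grad \<phi> v) \<bullet> (u - v)"
proof -
  have "\<nu> / 2 * (norm (u - v))\<^sup>2 \<le> \<phi> u - \<phi> v - grad \<phi> v \<bullet> (u - v)"
    "\<nu> / 2 * (norm (u - v))\<^sup>2 \<le> \<phi> v - \<phi> u - grad \<phi> u \<bullet> (v - u)"
    using assms unfolding strongly_convex_def by (metis, metis norm_minus_commute)
  then show ?thesis
    by (simp add: inner_diff_left inner_diff_right)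
qed

lemma smooth_fun_mono:
  assumes "smooth_fun l \<phi>" and "l \<le> l'"
  shows "smooth_fun l' \<phi>"
  using assms unfolding smooth_fun_def by (meson mult_right_mono norm_ge_zero order_trans)

text \<open>Between 0 and a unit vector, monotonicity bounds the change of the gradient from below
  by \<nu> and smoothness bounds it from above by \<open>l\<close>. This later yields \<mu> \<le> L,
  and with it the positivity of L, neither of which is assumed.\<close>

lemma strong_convexity_le_smoothness:
  fixes \<phi> :: "'a::euclidean_space \<Rightarrow> real"
  assumes "strongly_convex \<nu> \<phi>" and "smooth_fun l \<phi>"
  shows "\<nu> \<le> l"
proof -
  obtain b :: 'a where b: "norm b = 1"
    using norm_some_Basis by blast
  have "\<nu> * (norm (b - 0))\<^sup>2 \<le> (grad \<phi> b - grad \<phi> 0) \<bullet> (b - 0)"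
    using assms(1) by (rule strongly_convex_grad_mono)
  also have "\<dots> \<le> norm (grad \<phi> b - grad \<phi> 0) * norm (b - 0)"
    by (rule norm_cauchy_schwarz)
  also have "\<dots> \<le> l * norm (b - 0) * norm (b - 0)"
    using assms(2) unfolding smooth_fun_def by (intro mult_right_mono) (blast, simp)
  finally show ?thesis
    using b by simp
qed

text \<open>The exact field that \<open>stoch_Phi\<close> estimates. The sign of the second
  component turns descent in \<open>x\<close> and ascent in \<open>y\<close> into a single monotone
  operator.\<close>

definition saddle_op :: "('a::euclidean_space \<times> 'b::euclidean_space \<Rightarrow> real) \<Rightarrow> 'a \<times> 'b \<Rightarrow> 'a \<times> 'b"
  where "saddle_op f z = (grad_x f z, - grad_y f z)"

text \<open>At a saddle point, \<open>x\<close> minimises \<open>f\<close> with \<open>y\<close>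
  frozen and \<open>y\<close> minimises \<open>- f\<close> with \<open>x\<close> frozen, so both
  components of the gradient vanish.\<close>

lemma saddle_op_eq_zero:
  assumes "continuously_differentiable f" and "saddle_point f z"
  shows "saddle_op f z = 0"
proof -
  obtain x y where z: "z = (x, y)"
    by fastforce
  obtain G where G: "GDERIV f (x, y) :> G"
    using assms(1) unfolding continuously_differentiable_def by blast
  have "fst G = 0"
    using assms(2) by (intro grad_zero_at_min[OF GDERIV_partial_fst[OF G]])
      (simp add: saddle_point_def z)
  moreover have "- snd G = 0"
    using assms(2) by (intro grad_zero_at_min[OF GDERIV_minus[OF GDERIV_partial_snd[OF G]]])
      (simp add: saddle_point_def z)
  ultimately show ?thesis
    using grad_eqI[OF GDERIV_partial_fst[OF G]] grad_eqI[OF GDERIV_partial_snd[OF G]]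
    by (simp add: saddle_op_def grad_x_def grad_y_def z zero_prod_def)
qed

text \<open>Strong convexity is applied along \<open>y\<close> and \<open>y'\<close>, strong
  concavity along \<open>x\<close> and \<open>x'\<close>. In the sum of the four inequalities each
  value of \<open>f\<close> at a corner of the rectangle occurs once with either sign and cancels,
  leaving only the gradient terms.\<close>

lemma saddle_op_strongly_monotone:
  fixes f :: "'a::euclidean_space \<times> 'b::euclidean_space \<Rightarrow> real"
  assumes C1: "continuously_differentiable f"
    and convex: "\<And>y. strongly_convex \<mu>\<^sub>x (\<lambda>x. f (x, y))"
    and concave: "\<And>x. strongly_concave \<mu>\<^sub>y (\<lambda>y. f (x, y))"
  shows "min \<mu>\<^sub>x \<mu>\<^sub>y * (norm (u - v))\<^sup>2 \<le> (saddle_op f u - saddle_op f v) \<bullet> (u - v)"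
proof -
  obtain x y where u: "u = (x, y)"
    by fastforce
  obtain x' y' where v: "v = (x', y')"
    by fastforce
  \<comment> \<open>\<open>grad\<close> is a definite description, so pulling out the sign relies on
    existence of the gradient, which \<open>C1\<close> supplies.\<close>
  have neg: "grad (\<lambda>y. - f (a, y)) b = - grad (\<lambda>y. f (a, y)) b" for a b
  proof -
    obtain D where "GDERIV f (a, b) :> D"
      using C1 unfolding continuously_differentiable_def by blast
    then have "GDERIV (\<lambda>y. f (a, y)) b :> snd D"
      by (rule GDERIV_partial_snd)
    then show ?thesis
      using grad_eqI GDERIV_minus by metis
  qed
  have nx: "norm (x - x') = norm (x' - x)" and ny: "norm (y - y') = norm (y' - y)"
    by (simp_all add: norm_minus_commute)
  have "\<mu>\<^sub>x / 2 * (norm (x - x'))\<^sup>2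
      \<le> f (x', y) - f (x, y) - grad_x f (x, y) \<bullet> (x' - x)"
    using convex[of y] unfolding strongly_convex_def nx grad_x_def by simp
  moreover have "\<mu>\<^sub>x / 2 * (norm (x - x'))\<^sup>2
      \<le> f (x, y') - f (x', y') - grad_x f (x', y') \<bullet> (x - x')"
    using convex[of y'] unfolding strongly_convex_def grad_x_def by simp
  moreover have "\<mu>\<^sub>y / 2 * (norm (y - y'))\<^sup>2
      \<le> - f (x, y') - - f (x, y) - (- grad_y f (x, y)) \<bullet> (y' - y)"
    using concave[of x] unfolding strongly_concave_def strongly_convex_def ny grad_y_def neg
    by (simp only: fst_conv snd_conv)
  moreover have "\<mu>\<^sub>y / 2 * (norm (y - y'))\<^sup>2
      \<le> - f (x', y) - - f (x', y') - (- grad_y f (x', y')) \<bullet> (y - y')"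
    using concave[of x'] unfolding strongly_concave_def strongly_convex_def grad_y_def neg
    by (simp only: fst_conv snd_conv)
  ultimately have *: "\<mu>\<^sub>x * (norm (x - x'))\<^sup>2 + \<mu>\<^sub>y * (norm (y - y'))\<^sup>2
      \<le> (saddle_op f u - saddle_op f v) \<bullet> (u - v)"
    by (simp add: saddle_op_def u v inner_prod_def inner_diff_left inner_diff_right)
  have "min \<mu>\<^sub>x \<mu>\<^sub>y * (norm (u - v))\<^sup>2
      = min \<mu>\<^sub>x \<mu>\<^sub>y * (norm (x - x'))\<^sup>2 + min \<mu>\<^sub>x \<mu>\<^sub>y * (norm (y - y'))\<^sup>2"
    by (simp add: u v norm_Pair algebra_simps)
  also have "\<dots> \<le> \<mu>\<^sub>x * (norm (x - x'))\<^sup>2 + \<mu>\<^sub>y * (norm (y - y'))\<^sup>2"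
    by (intro add_mono mult_right_mono) auto
  finally show ?thesis
    using * by linarith
qed

text \<open>Passing from \<open>u\<close> to \<open>v\<close> one block at a time changes each
  component by at most \<open>L * (a + b)\<close>. Two such components and
  \<open>(a + b)\<^sup>2 \<le> 2 * (a\<^sup>2 + b\<^sup>2)\<close> give the factor 2.\<close>

lemma saddle_op_lipschitz:
  fixes f :: "'a::euclidean_space \<times> 'b::euclidean_space \<Rightarrow> real"
  assumes smooth_x: "\<And>y. smooth_fun L (\<lambda>x. f (x, y))"
    and smooth_y: "\<And>x. smooth_fun L (\<lambda>y. f (x, y))"
    and xy: "\<And>x y y'. norm (grad_x f (x, y) - grad_x f (x, y')) \<le> L * norm (y - y')"
    and yx: "\<And>x x' y. norm (grad_y f (x, y) - grad_y f (x', y)) \<le> L * norm (x - x')"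
  shows "norm (saddle_op f u - saddle_op f v) \<le> 2 * L * norm (u - v)"
proof -
  obtain x y where u: "u = (x, y)"
    by fastforce
  obtain x' y' where v: "v = (x', y')"
    by fastforce
  define a b where "a = norm (x - x')" and "b = norm (y - y')"
  \<comment> \<open>The sign of \<open>L\<close> is not given; the Lipschitz bound between a basis
    vector and 0 forces it.\<close>
  have "0 \<le> L * norm ((SOME i. i \<in> Basis) - 0 :: 'a)"
    using smooth_x[of 0] norm_ge_zero order_trans unfolding smooth_fun_def by blast
  then have L: "0 \<le> L"
    by (simp add: norm_some_Basis)
  have "norm (grad_x f u - grad_x f v)
      \<le> norm (grad_x f (x, y) - grad_x f (x', y)) + norm (grad_x f (x', y) - grad_x f (x', y'))"
    unfolding u v by (metis norm_diff_triangle_le order_refl)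
  also have "\<dots> \<le> L * a + L * b"
    using smooth_x[of y] xy[of x' y y'] unfolding smooth_fun_def a_def b_def grad_x_def
    by (intro add_mono) auto
  finally have gx: "norm (grad_x f u - grad_x f v) \<le> L * (a + b)"
    by (simp add: algebra_simps)
  have "norm (grad_y f u - grad_y f v)
      \<le> norm (grad_y f (x, y) - grad_y f (x', y)) + norm (grad_y f (x', y) - grad_y f (x', y'))"
    unfolding u v by (metis norm_diff_triangle_le order_refl)
  also have "\<dots> \<le> L * a + L * b"
    using smooth_y[of x'] yx[of x y x'] unfolding smooth_fun_def a_def b_def grad_y_def
    by (intro add_mono) auto
  finally have gy: "norm (grad_y f u - grad_y f v) \<le> L * (a + b)"
    by (simp add: algebra_simps)
  have "(norm (saddle_op f u - saddle_op f v))\<^sup>2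
      = (norm (grad_x f u - grad_x f v))\<^sup>2 + (norm (grad_y f u - grad_y f v))\<^sup>2"
    by (simp add: saddle_op_def norm_Pair norm_minus_commute[of "grad_y f u"])
  also have "\<dots> \<le> (L * (a + b))\<^sup>2 + (L * (a + b))\<^sup>2"
    by (intro add_mono power_mono gx gy) auto
  also have "\<dots> = 2 * L\<^sup>2 * (a + b)\<^sup>2"
    by (simp add: power_mult_distrib)
  also have "\<dots> \<le> 2 * L\<^sup>2 * (2 * (a\<^sup>2 + b\<^sup>2))"
    using sum_squares_bound[of a b] by (intro mult_left_mono) (auto simp: power2_sum)
  also have "\<dots> = (2 * L * norm (u - v))\<^sup>2"
    by (simp add: u v norm_Pair a_def b_def power_mult_distrib)
  finally show ?thesis
    by (rule power2_le_imp_le) (simp add: L)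
qed

subsection \<open>One step of the optimistic method\<close>

text \<open>Young's inequality with a free weight \<open>t\<close>, read off from the square of
  \<open>t *\<^sub>R a - b\<close>.\<close>

lemma norm_add_square_le:
  fixes a b :: "'a::real_inner"
  assumes "t > 0"
  shows "(norm (a + b))\<^sup>2 \<le> (1 + t) * (norm a)\<^sup>2 + (1 + 1 / t) * (norm b)\<^sup>2"
proof -
  have "0 \<le> (norm (t *\<^sub>R a - b))\<^sup>2 / t"
    using assms by simp
  also have "(norm (t *\<^sub>R a - b))\<^sup>2 = t\<^sup>2 * (norm a)\<^sup>2 - 2 * t * (a \<bullet> b) + (norm b)\<^sup>2"
    unfolding power2_norm_eq_inner
    by (simp add: inner_diff_left inner_diff_right inner_commute power2_eq_square)
  finally have "0 \<le> t * (norm a)\<^sup>2 - 2 * (a \<bullet> b) + (norm b)\<^sup>2 / t"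
    using assms by (simp add: field_simps power2_eq_square)
  moreover have "(norm (a + b))\<^sup>2 = (norm a)\<^sup>2 + 2 * (a \<bullet> b) + (norm b)\<^sup>2"
    by (simp add: power2_norm_eq_inner inner_add_left inner_add_right inner_commute)
  ultimately show ?thesis
    by (simp add: algebra_simps)
qed

text \<open>
  The Lyapunov function adds a third of \<open>\<parallel>w - z\<parallel>\<^sup>2\<close> to \<open>\<parallel>w - z\<^sup>*\<parallel>\<^sup>2\<close>. That term only depends on the
  current pair \<open>(z, w)\<close> and not on the stepsize, hence it can be carried from one stage to the
  next.
\<close>

lemma optimistic_step:
  fixes \<Phi> :: "'z::real_inner \<Rightarrow> 'z"
  assumes z': "z' = w - a *\<^sub>R g" and w': "w' = w - a *\<^sub>R g'"
    and mono: "\<mu> * (norm (z' - zs))\<^sup>2 \<le> \<Phi> z' \<bullet> (z' - zs)"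
    and lip: "norm (\<Phi> z' - \<Phi> z) \<le> 2 * L * norm (z' - z)"
    and a: "0 < a" "a * L \<le> 1 / 8" and \<mu>: "0 < \<mu>" "\<mu> \<le> L"
  shows "(norm (w' - zs))\<^sup>2 + (norm (w' - z'))\<^sup>2 / 3
      \<le> (1 - a * \<mu>) * ((norm (w - zs))\<^sup>2 + (norm (w - z))\<^sup>2 / 3)
        + 4 / 3 * a\<^sup>2 * (2 * (norm (g - \<Phi> z))\<^sup>2 + (norm (g' - \<Phi> z'))\<^sup>2)
        - 2 * a * ((g' - \<Phi> z') \<bullet> (z' - zs))
        + 8 / 3 * a\<^sup>2 * ((g' - \<Phi> z') \<bullet> (\<Phi> z' - g))"
proof -
  define d where "d = (norm (w - z))\<^sup>2"
  define N where "N = (norm g)\<^sup>2"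
  define D where "D = (norm (g' - g))\<^sup>2"
  have nonneg: "0 \<le> d" "0 \<le> N" "0 \<le> D"
    by (simp_all add: d_def N_def D_def)
  have V': "(norm (w' - zs))\<^sup>2
      = (norm (w - zs))\<^sup>2 - 2 * a * (g' \<bullet> (z' - zs)) + a\<^sup>2 * D - a\<^sup>2 * N"
    unfolding z' w' D_def N_def power2_norm_eq_inner
    by (simp add: inner_diff_left inner_diff_right inner_commute power2_eq_square algebra_simps)
  have d': "(norm (w' - z'))\<^sup>2 = a\<^sup>2 * D"
    unfolding z' w' D_def power2_norm_eq_inner
    by (simp add: inner_diff_left inner_diff_right inner_commute power2_eq_square algebra_simps)
  have D: "D = (norm (\<Phi> z' - g))\<^sup>2 + 2 * ((g' - \<Phi> z') \<bullet> (\<Phi> z' - g)) + (norm (g' - \<Phi> z'))\<^sup>2"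
    unfolding D_def power2_norm_eq_inner
    by (simp add: inner_diff_left inner_diff_right inner_commute algebra_simps)
  \<comment> \<open>Going through \<open>\<Phi> z\<close> separates the movement from
    \<open>z\<close> to \<open>z'\<close> from the noise of \<open>g\<close>. The 8 in
    \<open>P\<close> is 2 times the squared Lipschitz factor 2.\<close>
  have "(norm (\<Phi> z' - g))\<^sup>2 \<le> 2 * (norm (\<Phi> z' - \<Phi> z))\<^sup>2 + 2 * (norm (\<Phi> z - g))\<^sup>2"
    using norm_add_square_le[of 1 "\<Phi> z' - \<Phi> z" "\<Phi> z - g"] by simp
  moreover have "(norm (\<Phi> z' - \<Phi> z))\<^sup>2 \<le> (2 * L * norm (z' - z))\<^sup>2"
    using lip by (intro power_mono) auto
  moreover have "z' - z = - a *\<^sub>R g + (w - z)"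
    by (simp add: z')
  then have "(norm (z' - z))\<^sup>2 = (norm (- a *\<^sub>R g + (w - z)))\<^sup>2"
    by (simp only:)
  \<comment> \<open>The weight 2 keeps the factor of \<open>d\<close> at 3/2 and puts the larger
    factor 3 on \<open>N\<close>, where the final balance has room.\<close>
  then have "(norm (z' - z))\<^sup>2 \<le> 3 * a\<^sup>2 * N + 3 / 2 * d"
    using norm_add_square_le[of 2 "- a *\<^sub>R g" "w - z"]
    by (simp only: N_def d_def) (simp add: power_mult_distrib)
  then have "L\<^sup>2 * (norm (z' - z))\<^sup>2 \<le> L\<^sup>2 * (3 * a\<^sup>2 * N + 3 / 2 * d)"
    by (intro mult_left_mono) auto
  ultimately have P: "(norm (\<Phi> z' - g))\<^sup>2
      \<le> 8 * (L\<^sup>2 * (3 * a\<^sup>2 * N + 3 / 2 * d)) + 2 * (norm (g - \<Phi> z))\<^sup>2"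
    by (simp add: power_mult_distrib norm_minus_commute)
  have "(a * L)\<^sup>2 \<le> (1 / 8)\<^sup>2"
    using a \<mu> by (intro power_mono) auto
  then have "(a\<^sup>2 * L\<^sup>2) * (3 * a\<^sup>2 * N + 3 / 2 * d) \<le> 1 / 64 * (3 * a\<^sup>2 * N + 3 / 2 * d)"
    using nonneg by (intro mult_right_mono) (auto simp: power_mult_distrib power_divide)
  moreover have "a\<^sup>2 * (norm (\<Phi> z' - g))\<^sup>2
      \<le> a\<^sup>2 * (8 * (L\<^sup>2 * (3 * a\<^sup>2 * N + 3 / 2 * d)) + 2 * (norm (g - \<Phi> z))\<^sup>2)"
    using P by (intro mult_left_mono) auto
  ultimately have P': "a\<^sup>2 * (norm (\<Phi> z' - g))\<^sup>2
      \<le> 3 / 8 * (a\<^sup>2 * N) + 3 / 16 * d + 2 * (a\<^sup>2 * (norm (g - \<Phi> z))\<^sup>2)"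
    by (simp add: algebra_simps)
  \<comment> \<open>Monotonicity gives decay in terms of \<open>z'\<close>, whereas the Lyapunov
    function measures \<open>w\<close>. As \<open>w - zs\<close> is \<open>z' - zs\<close> plus
    \<open>a *\<^sub>R g\<close>, the exchange costs a multiple of
    \<open>a\<^sup>2 * N\<close>.\<close>
  have "(norm (w - zs))\<^sup>2 \<le> 2 * (norm (z' - zs))\<^sup>2 + 2 * (a\<^sup>2 * N)"
    using norm_add_square_le[of 1 "z' - zs" "a *\<^sub>R g"]
    by (simp add: z' N_def power_mult_distrib)
  then have "a * \<mu> * (norm (w - zs))\<^sup>2 \<le> a * \<mu> * (2 * (norm (z' - zs))\<^sup>2 + 2 * (a\<^sup>2 * N))"
    using a \<mu> by (intro mult_left_mono) auto
  moreover have "2 * a * (\<mu> * (norm (z' - zs))\<^sup>2) \<le> 2 * a * (\<Phi> z' \<bullet> (z' - zs))"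
    using a mono by (intro mult_left_mono) auto
  ultimately have M: "a * \<mu> * (norm (w - zs))\<^sup>2 - 2 * (a * \<mu>) * (a\<^sup>2 * N)
      \<le> 2 * a * (\<Phi> z' \<bullet> (z' - zs))"
    by (simp add: algebra_simps)
  have "a * \<mu> \<le> a * L"
    using a \<mu> by simp
  then have am: "a * \<mu> \<le> 1 / 8"
    using a by linarith
  have N: "a * \<mu> * (a\<^sup>2 * N) \<le> 1 / 8 * (a\<^sup>2 * N)"
    using am nonneg by (intro mult_right_mono) auto
  have d: "a * \<mu> * d \<le> 1 / 8 * d"
    using am nonneg by (intro mult_right_mono) auto
  define e1 e2 where "e1 = (g' - \<Phi> z') \<bullet> (z' - zs)" and "e2 = (g' - \<Phi> z') \<bullet> (\<Phi> z' - g)"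
  have split: "g' \<bullet> (z' - zs) = \<Phi> z' \<bullet> (z' - zs) + e1"
    by (simp add: e1_def inner_diff_left)
  have aD: "a\<^sup>2 * D = a\<^sup>2 * (norm (\<Phi> z' - g))\<^sup>2 + 2 * (a\<^sup>2 * e2) + a\<^sup>2 * (norm (g' - \<Phi> z'))\<^sup>2"
    unfolding D e2_def by (simp add: algebra_simps)
  \<comment> \<open>The final balance: \<open>a\<^sup>2 * D\<close> has the factor 4/3, namely 1
    from \<open>V'\<close> and 1/3 from \<open>d'\<close>. The coefficient of
    \<open>a\<^sup>2 * N\<close> is at most -1 + 4/3 * 3/8 + 2 * 1/8 = -1/4. For \<open>d\<close>
    the amount 4/3 * 3/16 = 1/4 arises, while at least (1 - 1/8) / 3 = 7/24 is available.\<close>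
  have "(1 - a * \<mu>) * ((norm (w - zs))\<^sup>2 + d / 3)
        + 4 / 3 * a\<^sup>2 * (2 * (norm (g - \<Phi> z))\<^sup>2 + (norm (g' - \<Phi> z'))\<^sup>2)
      = (norm (w - zs))\<^sup>2 - a * \<mu> * (norm (w - zs))\<^sup>2 + d / 3 - (a * \<mu> * d) / 3
        + 8 / 3 * (a\<^sup>2 * (norm (g - \<Phi> z))\<^sup>2) + 4 / 3 * (a\<^sup>2 * (norm (g' - \<Phi> z'))\<^sup>2)"
    by (simp add: field_simps)
  moreover have "0 \<le> a\<^sup>2 * N"
    using nonneg by simp
  moreover have "2 * (a * \<mu>) * (a\<^sup>2 * N) = 2 * (a * \<mu> * (a\<^sup>2 * N))"
    "2 * a * (\<Phi> z' \<bullet> (z' - zs) + e1) = 2 * a * (\<Phi> z' \<bullet> (z' - zs)) + 2 * a * e1"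
    "8 / 3 * a\<^sup>2 * e2 = 8 / 3 * (a\<^sup>2 * e2)"
    by (simp_all add: algebra_simps)
  ultimately show ?thesis
    unfolding V' d' split e1_def[symmetric] e2_def[symmetric] d_def[symmetric]
    using aD P' M N d nonneg(1) by linarith
qed

subsection \<open>Square-integrable random vectors\<close>

definition sq_integrable :: "'w measure \<Rightarrow> ('w \<Rightarrow> 'a::euclidean_space) \<Rightarrow> bool" where
  "sq_integrable M X \<longleftrightarrow> X \<in> borel_measurable M \<and> integrable M (\<lambda>\<omega>. (norm (X \<omega>))\<^sup>2)"

lemma sq_integrableD:
  assumes "sq_integrable M X"
  shows "X \<in> borel_measurable M" and "integrable M (\<lambda>\<omega>. (norm (X \<omega>))\<^sup>2)"
  using assms by (simp_all add: sq_integrable_def)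

lemma sq_integrable_mono:
  assumes "sq_integrable M X" and [measurable]: "Y \<in> borel_measurable M"
    and "\<And>\<omega>. norm (Y \<omega>) \<le> norm (X \<omega>)"
  shows "sq_integrable M Y"
  unfolding sq_integrable_def
proof
  show "integrable M (\<lambda>\<omega>. (norm (Y \<omega>))\<^sup>2)"
    by (rule Bochner_Integration.integrable_bound[OF sq_integrableD(2)[OF assms(1)]])
      (auto intro!: power_mono assms(3))
qed fact

lemma sq_integrable_scaleR:
  assumes "sq_integrable M X"
  shows "sq_integrable M (\<lambda>\<omega>. c *\<^sub>R X \<omega>)"
  using assms by (auto simp: sq_integrable_def power_mult_distrib)

lemma sq_integrable_add:
  fixes X :: "'w \<Rightarrow> 'a::euclidean_space"
  assumes X: "sq_integrable M X" and Y: "sq_integrable M Y"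
  shows "sq_integrable M (\<lambda>\<omega>. X \<omega> + Y \<omega>)"
  unfolding sq_integrable_def
proof
  note [measurable] = sq_integrableD(1)[OF X] sq_integrableD(1)[OF Y]
  show "(\<lambda>\<omega>. X \<omega> + Y \<omega>) \<in> borel_measurable M"
    by measurable
  have "integrable M (\<lambda>\<omega>. 2 * (norm (X \<omega>))\<^sup>2 + 2 * (norm (Y \<omega>))\<^sup>2)"
    using sq_integrableD(2)[OF X] sq_integrableD(2)[OF Y] by simp
  then show "integrable M (\<lambda>\<omega>. (norm (X \<omega> + Y \<omega>))\<^sup>2)"
  proof (rule Bochner_Integration.integrable_bound)
    show "AE \<omega> in M. norm ((norm (X \<omega> + Y \<omega>))\<^sup>2)
        \<le> norm (2 * (norm (X \<omega>))\<^sup>2 + 2 * (norm (Y \<omega>))\<^sup>2)"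
      using norm_add_square_le[of 1 "X _" "Y _"] by auto
  qed measurable
qed

lemma sq_integrable_diff:
  assumes "sq_integrable M X" and "sq_integrable M Y"
  shows "sq_integrable M (\<lambda>\<omega>. X \<omega> - Y \<omega>)"
  using sq_integrable_add[OF assms(1) sq_integrable_scaleR[OF assms(2), of "-1"]] by simp

lemma sq_integrable_Pair:
  assumes X: "sq_integrable M X" and Y: "sq_integrable M Y"
  shows "sq_integrable M (\<lambda>\<omega>. (X \<omega>, Y \<omega>))"
  using assms by (auto simp: sq_integrable_def norm_Pair)

lemma
  fixes X :: "'w \<Rightarrow> 'a::euclidean_space \<times> 'b::euclidean_space"
  assumes "X \<in> borel_measurable M"
  shows borel_measurable_fst: "(\<lambda>\<omega>. fst (X \<omega>)) \<in> borel_measurable M"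
    and borel_measurable_snd: "(\<lambda>\<omega>. snd (X \<omega>)) \<in> borel_measurable M"
  using assms by (auto intro!: borel_measurable_continuous_on[where f = fst]
      borel_measurable_continuous_on[where f = snd] continuous_intros)

lemma
  fixes X :: "'w \<Rightarrow> 'a::euclidean_space \<times> 'b::euclidean_space"
  assumes X: "sq_integrable M X"
  shows sq_integrable_fst: "sq_integrable M (\<lambda>\<omega>. fst (X \<omega>))"
    and sq_integrable_snd: "sq_integrable M (\<lambda>\<omega>. snd (X \<omega>))"
  using borel_measurable_fst borel_measurable_snd sq_integrableD(1)[OF X]
  by (metis norm_fst_le prod.collapse sq_integrable_mono[OF X],
      metis norm_snd_le prod.collapse sq_integrable_mono[OF X])

lemma (in finite_measure) sq_integrable_const: "sq_integrable M (\<lambda>\<omega>. c)"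
  by (simp add: sq_integrable_def)

lemma integrable_inner_sq_integrable:
  fixes X :: "'w \<Rightarrow> 'a::euclidean_space"
  assumes X: "sq_integrable M X" and Y: "sq_integrable M Y"
  shows "integrable M (\<lambda>\<omega>. X \<omega> \<bullet> Y \<omega>)"
proof (rule Bochner_Integration.integrable_bound)
  note [measurable] = sq_integrableD(1)[OF X] sq_integrableD(1)[OF Y]
  show "(\<lambda>\<omega>. X \<omega> \<bullet> Y \<omega>) \<in> borel_measurable M"
    by measurable
  show "integrable M (\<lambda>\<omega>. (norm (X \<omega>))\<^sup>2 + (norm (Y \<omega>))\<^sup>2)"
    using sq_integrableD(2)[OF X] sq_integrableD(2)[OF Y] by simp
  have "\<bar>x \<bullet> y\<bar> \<le> (norm x)\<^sup>2 + (norm y)\<^sup>2" for x y :: 'a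
  proof -
    have "\<bar>x \<bullet> y\<bar> \<le> norm x * norm y"
      by (rule Cauchy_Schwarz_ineq2)
    moreover have "0 \<le> norm x * norm y"
      by simp
    moreover have "2 * norm x * norm y \<le> (norm x)\<^sup>2 + (norm y)\<^sup>2"
      by (rule sum_squares_bound)
    ultimately show ?thesis
      by linarith
  qed
  then show "AE \<omega> in M. norm (X \<omega> \<bullet> Y \<omega>) \<le> norm ((norm (X \<omega>))\<^sup>2 + (norm (Y \<omega>))\<^sup>2)"
    by auto
qed

lemma borel_measurable_lipschitz:
  fixes \<Phi> :: "'a::euclidean_space \<Rightarrow> 'b::euclidean_space"
  assumes lip: "\<And>u v. norm (\<Phi> u - \<Phi> v) \<le> C * norm (u - v)"
  shows "\<Phi> \<in> borel_measurable borel"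
proof -
  \<comment> \<open>The absolute value provides the nonnegative constant that
    \<open>lipschitz_on\<close> demands, since the sign of \<open>C\<close> is open.\<close>
  have "\<bar>C\<bar>-lipschitz_on UNIV \<Phi>"
  proof (rule lipschitz_onI)
    show "dist (\<Phi> u) (\<Phi> v) \<le> \<bar>C\<bar> * dist u v" for u v
      using lip[of u v] mult_right_mono[OF abs_ge_self[of C] norm_ge_zero[of "u - v"]]
      by (simp add: dist_norm)
  qed simp
  then show ?thesis
    by (intro borel_measurable_continuous_onI lipschitz_on_continuous_on)
qed

text \<open>A Lipschitz map grows at most linearly: its difference to the value at 0 is dominated by
  \<open>C *\<^sub>R X\<close>, and constants are square-integrable for a finite measure.\<close>

lemma (in finite_measure) sq_integrable_lipschitz:
  fixes \<Phi> :: "'z::euclidean_space \<Rightarrow> 'b::euclidean_space"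
  assumes X: "sq_integrable M X" and lip: "\<And>u v. norm (\<Phi> u - \<Phi> v) \<le> C * norm (u - v)"
  shows "sq_integrable M (\<lambda>\<omega>. \<Phi> (X \<omega>))"
proof -
  note [measurable] = borel_measurable_lipschitz[OF lip]
  note [measurable] = sq_integrableD(1)[OF X]
  have "sq_integrable M (\<lambda>\<omega>. \<Phi> (X \<omega>) - \<Phi> 0)"
  proof (rule sq_integrable_mono)
    show "sq_integrable M (\<lambda>\<omega>. C *\<^sub>R X \<omega>)"
      using X by (rule sq_integrable_scaleR)
    show "norm (\<Phi> (X \<omega>) - \<Phi> 0) \<le> norm (C *\<^sub>R X \<omega>)" for \<omega>
      using lip[of "X \<omega>" 0] mult_right_mono[OF abs_ge_self[of C] norm_ge_zero[of "X \<omega>"]] by simp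
  qed measurable
  then show ?thesis
    using sq_integrable_add[OF _ sq_integrable_const[of "\<Phi> 0"]] by fastforce
qed

subsection \<open>Conditional moments and independence\<close>

text \<open>The nonnegative conditional expectation makes sense without integrability, so a
  conditional variance bound can be integrated first; finiteness of the second moment then comes out
  as a conclusion.\<close>

lemma (in prob_space) sq_integrable_of_nn_cond_exp_le:
  assumes sub: "subalgebra M F" and [measurable]: "X \<in> borel_measurable M"
    and le: "AE \<omega> in M. nn_cond_exp M F (\<lambda>\<omega>. ennreal ((norm (X \<omega>))\<^sup>2)) \<omega> \<le> ennreal c"
    and c: "0 \<le> c"
  shows "sq_integrable M X" and "expectation (\<lambda>\<omega>. (norm (X \<omega>))\<^sup>2) \<le> c"
proof -
  interpret finite_measure_subalgebra M F
    by unfold_locales (rule sub)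
  have "(\<integral>\<^sup>+\<omega>. ennreal ((norm (X \<omega>))\<^sup>2) \<partial>M)
      = (\<integral>\<^sup>+\<omega>. nn_cond_exp M F (\<lambda>\<omega>. ennreal ((norm (X \<omega>))\<^sup>2)) \<omega> \<partial>M)"
    using nn_cond_exp_intg[of "\<lambda>_. 1" "\<lambda>\<omega>. ennreal ((norm (X \<omega>))\<^sup>2)"] by simp
  also have "\<dots> \<le> (\<integral>\<^sup>+\<omega>. ennreal c \<partial>M)"
    using le by (rule nn_integral_mono_AE)
  also have "\<dots> = ennreal c"
    by (simp add: emeasure_space_1)
  finally have *: "(\<integral>\<^sup>+\<omega>. ennreal ((norm (X \<omega>))\<^sup>2) \<partial>M) \<le> ennreal c" .
  then have **: "integrable M (\<lambda>\<omega>. (norm (X \<omega>))\<^sup>2)"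
    by (intro integrableI_bounded) (auto simp: le_less_trans)
  then show "sq_integrable M X"
    by (simp add: sq_integrable_def)
  show "expectation (\<lambda>\<omega>. (norm (X \<omega>))\<^sup>2) \<le> c"
    using * c by (simp add: nn_integral_eq_integral[OF **])
qed

text \<open>Turns independence of sigma-algebras into a product law for \<open>X\<close> and any
  \<open>Y\<close> determined by \<open>F\<close>. Product measures are characterised by rectangles,
  and on a rectangle the claim is the independence of two events.\<close>

lemma (in prob_space)
  assumes X [measurable]: "X \<in> measurable M N" and Y: "Y \<in> measurable (sigma (space M) F) N'"
    and F: "sigma_algebra (space M) F"
    and indep: "indep_set (sets (vimage_algebra (space M) X N)) F"
  shows measurable_of_indep_set: "Y \<in> measurable M N'"
    and distr_pair_of_indep_set:
      "distr M N' Y \<Otimes>\<^sub>M distr M N X = distr M (N' \<Otimes>\<^sub>M N) (\<lambda>\<omega>. (Y \<omega>, X \<omega>))"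
proof -
  interpret F: sigma_algebra "space M" F
    by (rule F)
  have sets_F: "sets (sigma (space M) F) = F" "space (sigma (space M) F) = space M"
    using F.space_closed by (auto simp: F.sigma_sets_eq)
  show YM [measurable]: "Y \<in> measurable M N'"
    using Y indep_setD_ev2[OF indep] sets_F by (auto simp: measurable_def)
  interpret PX: prob_space "distr M N X"
    by (rule prob_space_distr) measurable
  interpret PY: prob_space "distr M N' Y"
    by (rule prob_space_distr) measurable
  show "distr M N' Y \<Otimes>\<^sub>M distr M N X = distr M (N' \<Otimes>\<^sub>M N) (\<lambda>\<omega>. (Y \<omega>, X \<omega>))"
  proof (rule pair_measure_eqI)
    fix A B assume A: "A \<in> sets (distr M N' Y)" and B: "B \<in> sets (distr M N X)"
    then have [measurable]: "A \<in> sets N'" "B \<in> sets N"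
      by simp_all
    have "Y -` A \<inter> space M \<in> F"
      using measurable_sets[OF Y, of A] sets_F by simp
    moreover have "X -` B \<inter> space M \<in> sets (vimage_algebra (space M) X N)"
      by (rule in_vimage_algebra) measurable
    moreover have "(\<lambda>\<omega>. (Y \<omega>, X \<omega>)) -` (A \<times> B) \<inter> space M
        = (X -` B \<inter> space M) \<inter> (Y -` A \<inter> space M)"
      by auto
    ultimately show "emeasure (distr M N' Y) A * emeasure (distr M N X) B
        = emeasure (distr M (N' \<Otimes>\<^sub>M N) (\<lambda>\<omega>. (Y \<omega>, X \<omega>))) (A \<times> B)"
      using indep_setD[OF indep] by (simp add: emeasure_distr emeasure_eq_measure mult.commute
          flip: ennreal_mult)
  qed (auto intro: PX.sigma_finite_measure_axioms PY.sigma_finite_measure_axioms)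
qed

text \<open>The freezing principle: under a product law, Fubini allows \<open>X\<close> to be
  averaged out while \<open>Y\<close> is held fixed.\<close>

lemma (in prob_space)
  fixes h :: "'c \<times> 'd \<Rightarrow> real"
  assumes X [measurable]: "X \<in> measurable M N" and Y [measurable]: "Y \<in> measurable M N'"
    and distr: "distr M N' Y \<Otimes>\<^sub>M distr M N X = distr M (N' \<Otimes>\<^sub>M N) (\<lambda>\<omega>. (Y \<omega>, X \<omega>))"
    and h: "h \<in> borel_measurable (N' \<Otimes>\<^sub>M N)"
    and int: "integrable M (\<lambda>\<omega>. h (Y \<omega>, X \<omega>))"
  shows integrable_distr_fubini: "integrable M (\<lambda>\<omega>. \<integral>s. h (Y \<omega>, s) \<partial>distr M N X)"
    and expectation_distr_fubini:
      "expectation (\<lambda>\<omega>. h (Y \<omega>, X \<omega>)) = expectation (\<lambda>\<omega>. \<integral>s. h (Y \<omega>, s) \<partial>distr M N X)"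
proof -
  interpret PX: prob_space "distr M N X"
    by (rule prob_space_distr) measurable
  interpret PY: prob_space "distr M N' Y"
    by (rule prob_space_distr) measurable
  interpret P: pair_sigma_finite "distr M N' Y" "distr M N X" ..
  have [measurable]: "h \<in> borel_measurable (N' \<Otimes>\<^sub>M distr M N X)"
    using h by simp
  have int': "integrable (distr M N' Y \<Otimes>\<^sub>M distr M N X) h"
    unfolding distr using int h by (subst integrable_distr_eq) auto
  have m: "(\<lambda>y. \<integral>s. h (y, s) \<partial>distr M N X) \<in> borel_measurable N'"
    by measurable
  show "integrable M (\<lambda>\<omega>. \<integral>s. h (Y \<omega>, s) \<partial>distr M N X)"
    using P.integrable_fst'[OF int'] by (simp add: integrable_distr_eq[OF Y m])
  have "expectation (\<lambda>\<omega>. h (Y \<omega>, X \<omega>)) = integral\<^sup>L (distr M N' Y \<Otimes>\<^sub>M distr M N X) h"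
    unfolding distr using h by (subst integral_distr) auto
  also have "\<dots> = (\<integral>y. (\<integral>s. h (y, s) \<partial>distr M N X) \<partial>distr M N' Y)"
    using P.integral_fst'[OF int'] by simp
  also have "\<dots> = expectation (\<lambda>\<omega>. \<integral>s. h (Y \<omega>, s) \<partial>distr M N X)"
    by (rule integral_distr[OF Y m])
  finally show "expectation (\<lambda>\<omega>. h (Y \<omega>, X \<omega>))
      = expectation (\<lambda>\<omega>. \<integral>s. h (Y \<omega>, s) \<partial>distr M N X)" .
qed

text \<open>
  Conditioning on \<open>z\<close> alone is enough: independence makes the conditional expectation given the
  whole past equal to \<open>\<integral>s. G (z, s)\<close>, a function of \<open>z\<close>.
\<close>

lemma (in prob_space) expectation_mult_indep_past:
  fixes G :: "'z::euclidean_space \<times> 's \<Rightarrow> real" and v :: "'a \<Rightarrow> real"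
  assumes X: "X \<in> measurable M N"
    and F: "sigma_algebra (space M) F"
    and indep: "indep_set (sets (vimage_algebra (space M) X N)) F"
    and z: "z \<in> borel_measurable (sigma (space M) F)"
    and v: "v \<in> borel_measurable (sigma (space M) F)"
    and G: "G \<in> borel_measurable (borel \<Otimes>\<^sub>M N)"
    and int: "integrable M (\<lambda>\<omega>. G (z \<omega>, X \<omega>))"
    and int_v: "integrable M (\<lambda>\<omega>. G (z \<omega>, X \<omega>) * v \<omega>)"
    and cond: "AE \<omega> in M. real_cond_exp M (vimage_algebra (space M) z borel)
      (\<lambda>\<omega>. G (z \<omega>, X \<omega>)) \<omega> = \<phi> (z \<omega>)"
    and \<phi>: "\<phi> \<in> borel_measurable borel"
  shows "expectation (\<lambda>\<omega>. G (z \<omega>, X \<omega>) * v \<omega>) = expectation (\<lambda>\<omega>. \<phi> (z \<omega>) * v \<omega>)"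
proof -
  note [measurable] = X G \<phi>
  let ?H = "\<lambda>u. \<integral>s. G (u, s) \<partial>distr M N X"
  let ?Z = "vimage_algebra (space M) z borel"
  have zv: "(\<lambda>\<omega>. (z \<omega>, v \<omega>)) \<in> sigma (space M) F \<rightarrow>\<^sub>M borel \<Otimes>\<^sub>M borel"
    using z v by measurable
  note zM [measurable] = measurable_of_indep_set[OF X z F indep]
    and vM [measurable] = measurable_of_indep_set[OF X v F indep]
  note dz = distr_pair_of_indep_set[OF X z F indep]
    and dzv = distr_pair_of_indep_set[OF X zv F indep]
  interpret PX: prob_space "distr M N X"
    by (rule prob_space_distr) measurable
  have [measurable]: "G \<in> borel_measurable (borel \<Otimes>\<^sub>M distr M N X)"
    using G by simp
  have H [measurable]: "?H \<in> borel_measurable borel"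
    by measurable
  have sub: "subalgebra M ?Z"
    unfolding subalgebra_def using zM by (auto simp: sets_vimage_algebra2)
  interpret Z: finite_measure_subalgebra M ?Z
    by unfold_locales (rule sub)
  have zZ [measurable]: "z \<in> borel_measurable ?Z"
    by (rule measurable_vimage_algebra1) simp
  \<comment> \<open>Every test set of the sigma-algebra of \<open>z\<close> is a preimage under
    \<open>z\<close>, so its indicator is a function of \<open>z\<close> and stays fixed while
    \<open>X\<close> is averaged out.\<close>
  have "AE \<omega> in M. real_cond_exp M ?Z (\<lambda>\<omega>. G (z \<omega>, X \<omega>)) \<omega> = ?H (z \<omega>)"
  proof (rule Z.real_cond_exp_charact)
    fix A assume "A \<in> sets ?Z"
    then obtain B where B [measurable]: "B \<in> sets borel" and A: "A = z -` B \<inter> space M"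
      by (auto simp: sets_vimage_algebra2)
    have AM: "A \<in> sets M"
      unfolding A by measurable
    have ind: "indicator A \<omega> = (indicator B (z \<omega>) :: real)" if "\<omega> \<in> space M" for \<omega>
      using that by (auto simp: A indicator_def)
    have "integrable M (\<lambda>\<omega>. indicator A \<omega> *\<^sub>R G (z \<omega>, X \<omega>))"
      by (rule integrable_mult_indicator[OF AM int])
    then have "integrable M (\<lambda>\<omega>. indicator B (z \<omega>) * G (z \<omega>, X \<omega>))"
      by (rule iffD1[OF Bochner_Integration.integrable_cong, rotated -1]) (auto simp: ind)
    then have "expectation (\<lambda>\<omega>. indicator B (z \<omega>) * G (z \<omega>, X \<omega>))
        = expectation (\<lambda>\<omega>. indicator B (z \<omega>) * ?H (z \<omega>))"
      using expectation_distr_fubini[OF X zM dz, of "\<lambda>(u, s). indicator B u * G (u, s)"] by simp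
    then show "(\<integral>\<omega>\<in>A. G (z \<omega>, X \<omega>) \<partial>M) = (\<integral>\<omega>\<in>A. ?H (z \<omega>) \<partial>M)"
      unfolding set_lebesgue_integral_def using ind
      by (simp cong: Bochner_Integration.integral_cong)
  next
    show "integrable M (\<lambda>\<omega>. ?H (z \<omega>))"
      using integrable_distr_fubini[OF X zM dz G int] .
  qed (use int in measurable)
  then have H_eq: "AE \<omega> in M. ?H (z \<omega>) = \<phi> (z \<omega>)"
    using cond by eventually_elim simp
  \<comment> \<open>The freezing principle again, now with the pair \<open>(z, v)\<close> held
    fixed: \<open>v\<close> leaves the inner integral as a constant factor.\<close>
  have "expectation (\<lambda>\<omega>. G (z \<omega>, X \<omega>) * v \<omega>) = expectation (\<lambda>\<omega>. ?H (z \<omega>) * v \<omega>)"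
  proof -
    have "(\<lambda>q. G (fst (fst q), snd q) * snd (fst q))
        \<in> borel_measurable ((borel \<Otimes>\<^sub>M borel) \<Otimes>\<^sub>M N)"
      by measurable
    from expectation_distr_fubini[OF X measurable_of_indep_set[OF X zv F indep] dzv this]
    show ?thesis
      using int_v by simp
  qed
  also have "\<dots> = expectation (\<lambda>\<omega>. \<phi> (z \<omega>) * v \<omega>)"
    by (rule integral_cong_AE) (use H_eq in \<open>auto elim: eventually_mono\<close>)
  finally show ?thesis .
qed

lemma inner_vec_cond_exp:
  assumes "b \<in> Basis"
  shows "vec_cond_exp M F X \<omega> \<bullet> b = real_cond_exp M F (\<lambda>\<omega>. X \<omega> \<bullet> b) \<omega>"
  using assms unfolding vec_cond_exp_def by (rule inner_sum_left_Basis)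

text \<open>States that the noise is orthogonal to the past. It reduces to the scalar case because
  \<open>vec_cond_exp\<close> is built from coordinates.\<close>

lemma (in prob_space) expectation_inner_indep_past:
  fixes G :: "'z::euclidean_space \<times> 's \<Rightarrow> 'b::euclidean_space" and v :: "'a \<Rightarrow> 'b"
  assumes X: "X \<in> measurable M N"
    and F: "sigma_algebra (space M) F"
    and indep: "indep_set (sets (vimage_algebra (space M) X N)) F"
    and z: "z \<in> borel_measurable (sigma (space M) F)"
    and v: "v \<in> borel_measurable (sigma (space M) F)"
    and G: "G \<in> borel_measurable (borel \<Otimes>\<^sub>M N)"
    and sq_G: "sq_integrable M (\<lambda>\<omega>. G (z \<omega>, X \<omega>))"
    and sq_\<phi>: "sq_integrable M (\<lambda>\<omega>. \<phi> (z \<omega>))"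
    and sq_v: "sq_integrable M v"
    and cond: "AE \<omega> in M. vec_cond_exp M (vimage_algebra (space M) z borel)
      (\<lambda>\<omega>. G (z \<omega>, X \<omega>)) \<omega> = \<phi> (z \<omega>)"
    and \<phi>: "\<phi> \<in> borel_measurable borel"
  shows "expectation (\<lambda>\<omega>. (G (z \<omega>, X \<omega>) - \<phi> (z \<omega>)) \<bullet> v \<omega>) = 0"
proof -
  have comp: "integrable M (\<lambda>\<omega>. (W \<omega> \<bullet> b) * (v \<omega> \<bullet> b))"
    if b: "b \<in> Basis" and W: "sq_integrable M W" for W :: "'a \<Rightarrow> 'b" and b
  proof -
    note [measurable] = sq_integrableD(1)[OF W] sq_integrableD(1)[OF sq_v]
    \<comment> \<open>Projecting \<open>v\<close> onto \<open>b\<close> makes the product of two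
      coordinates an inner product of square-integrable vectors.\<close>
    have "sq_integrable M (\<lambda>\<omega>. (v \<omega> \<bullet> b) *\<^sub>R b)"
    proof (rule sq_integrable_mono[OF sq_v])
      show "norm ((v \<omega> \<bullet> b) *\<^sub>R b) \<le> norm (v \<omega>)" for \<omega>
        using b by (simp add: Basis_le_norm)
    qed measurable
    from integrable_inner_sq_integrable[OF W this] show ?thesis
      by (simp add: mult.commute)
  qed
  have eq: "expectation (\<lambda>\<omega>. (G (z \<omega>, X \<omega>) \<bullet> b) * (v \<omega> \<bullet> b))
      = expectation (\<lambda>\<omega>. (\<phi> (z \<omega>) \<bullet> b) * (v \<omega> \<bullet> b))" if b: "b \<in> Basis" for b
  proof -
    have "AE \<omega> in M. real_cond_exp M (vimage_algebra (space M) z borel)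
        (\<lambda>\<omega>. G (z \<omega>, X \<omega>) \<bullet> b) \<omega> = \<phi> (z \<omega>) \<bullet> b"
      using cond by eventually_elim (simp flip: inner_vec_cond_exp[OF b])
    moreover have "integrable M (\<lambda>\<omega>. G (z \<omega>, X \<omega>) \<bullet> b)"
      by (rule integrable_inner_sq_integrable[OF sq_G sq_integrable_const])
    moreover have "(\<lambda>\<omega>. v \<omega> \<bullet> b) \<in> borel_measurable (sigma (space M) F)"
      using v by measurable
    moreover have "(\<lambda>q. G q \<bullet> b) \<in> borel_measurable (borel \<Otimes>\<^sub>M N)"
      using G by measurable
    moreover have "(\<lambda>u. \<phi> u \<bullet> b) \<in> borel_measurable borel"
      using \<phi> by measurable
    ultimately show ?thesis
      using comp[OF b sq_G]
      by (intro expectation_mult_indep_past[OF X F indep z, where G = "\<lambda>q. G q \<bullet> b"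
            and \<phi> = "\<lambda>u. \<phi> u \<bullet> b"])
  qed
  have "expectation (\<lambda>\<omega>. (G (z \<omega>, X \<omega>) - \<phi> (z \<omega>)) \<bullet> v \<omega>)
      = expectation (\<lambda>\<omega>. \<Sum>b\<in>Basis. (G (z \<omega>, X \<omega>) \<bullet> b) * (v \<omega> \<bullet> b) - (\<phi> (z \<omega>) \<bullet> b) * (v \<omega> \<bullet> b))"
    unfolding inner_diff_left left_diff_distrib sum_subtractf euclidean_inner[symmetric] ..
  also have "\<dots> = (\<Sum>b\<in>Basis. expectation (\<lambda>\<omega>. (G (z \<omega>, X \<omega>) \<bullet> b) * (v \<omega> \<bullet> b))
      - expectation (\<lambda>\<omega>. (\<phi> (z \<omega>) \<bullet> b) * (v \<omega> \<bullet> b)))"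
    using comp sq_G sq_\<phi> by (simp add: Bochner_Integration.integral_sum)
  also have "\<dots> = 0"
    by (simp add: eq)
  finally show ?thesis .
qed

subsection \<open>Expected progress\<close>

text \<open>In expectation the two cross terms of \<open>optimistic_step\<close> vanish by
  \<open>orth\<close>. The noise bound is \<open>2 * s\<close> because both partial gradients
  contribute \<open>s\<close>, and 4/3 * (2 * 2 + 2) = 8.\<close>

lemma (in prob_space) optimistic_step_expectation:
  fixes \<Phi> :: "'z::euclidean_space \<Rightarrow> 'z" and z w z' w' g g' :: "'a \<Rightarrow> 'z"
  assumes z': "\<And>\<omega>. z' \<omega> = w \<omega> - a *\<^sub>R g \<omega>" and w': "\<And>\<omega>. w' \<omega> = w \<omega> - a *\<^sub>R g' \<omega>"
    and mono: "\<And>u. \<mu> * (norm (u - zs))\<^sup>2 \<le> \<Phi> u \<bullet> (u - zs)"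
    and lip: "\<And>u v. norm (\<Phi> u - \<Phi> v) \<le> 2 * L * norm (u - v)"
    and a: "0 < a" "a * L \<le> 1 / 8" and \<mu>: "0 < \<mu>" "\<mu> \<le> L"
    and z_sq: "sq_integrable M z" and w_sq: "sq_integrable M w"
    and g_sq: "sq_integrable M g" and g'_sq: "sq_integrable M g'"
    and noise: "expectation (\<lambda>\<omega>. (norm (g \<omega> - \<Phi> (z \<omega>)))\<^sup>2) \<le> 2 * s"
      "expectation (\<lambda>\<omega>. (norm (g' \<omega> - \<Phi> (z' \<omega>)))\<^sup>2) \<le> 2 * s"
    and orth: "expectation (\<lambda>\<omega>. (g' \<omega> - \<Phi> (z' \<omega>)) \<bullet> (z' \<omega> - zs)) = 0"
      "expectation (\<lambda>\<omega>. (g' \<omega> - \<Phi> (z' \<omega>)) \<bullet> (\<Phi> (z' \<omega>) - g \<omega>)) = 0"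
  shows "expectation (\<lambda>\<omega>. (norm (w' \<omega> - zs))\<^sup>2 + (norm (w' \<omega> - z' \<omega>))\<^sup>2 / 3)
      \<le> (1 - a * \<mu>) * expectation (\<lambda>\<omega>. (norm (w \<omega> - zs))\<^sup>2 + (norm (w \<omega> - z \<omega>))\<^sup>2 / 3)
        + 8 * a\<^sup>2 * s"
proof -
  have z'_sq: "sq_integrable M z'" and w'_sq: "sq_integrable M w'"
    using w_sq g_sq g'_sq unfolding z'[abs_def] w'[abs_def]
    by (auto intro!: sq_integrable_diff sq_integrable_scaleR)
  have const: "sq_integrable M (\<lambda>\<omega>. zs)"
    by (rule sq_integrable_const)
  have e_sq: "sq_integrable M (\<lambda>\<omega>. g \<omega> - \<Phi> (z \<omega>))"
    and e'_sq: "sq_integrable M (\<lambda>\<omega>. g' \<omega> - \<Phi> (z' \<omega>))"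
    and h_sq: "sq_integrable M (\<lambda>\<omega>. \<Phi> (z' \<omega>) - g \<omega>)"
    using g_sq g'_sq sq_integrable_lipschitz[OF z_sq lip] sq_integrable_lipschitz[OF z'_sq lip]
    by (auto intro!: sq_integrable_diff)
  note sq = sq_integrableD(2)[OF sq_integrable_diff[OF w_sq const]]
    sq_integrableD(2)[OF sq_integrable_diff[OF w'_sq const]]
    sq_integrableD(2)[OF sq_integrable_diff[OF w_sq z_sq]]
    sq_integrableD(2)[OF sq_integrable_diff[OF w'_sq z'_sq]]
    sq_integrableD(2)[OF e_sq] sq_integrableD(2)[OF e'_sq]
    integrable_inner_sq_integrable[OF e'_sq sq_integrable_diff[OF z'_sq const]]
    integrable_inner_sq_integrable[OF e'_sq h_sq]
  have "expectation (\<lambda>\<omega>. (norm (w' \<omega> - zs))\<^sup>2 + (norm (w' \<omega> - z' \<omega>))\<^sup>2 / 3)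
      \<le> expectation (\<lambda>\<omega>. (1 - a * \<mu>) * ((norm (w \<omega> - zs))\<^sup>2 + (norm (w \<omega> - z \<omega>))\<^sup>2 / 3)
        + 4 / 3 * a\<^sup>2 * (2 * (norm (g \<omega> - \<Phi> (z \<omega>)))\<^sup>2 + (norm (g' \<omega> - \<Phi> (z' \<omega>)))\<^sup>2)
        - 2 * a * ((g' \<omega> - \<Phi> (z' \<omega>)) \<bullet> (z' \<omega> - zs))
        + 8 / 3 * a\<^sup>2 * ((g' \<omega> - \<Phi> (z' \<omega>)) \<bullet> (\<Phi> (z' \<omega>) - g \<omega>)))"
    using sq by (intro integral_mono optimistic_step[where \<Phi> = \<Phi>, OF z' w' mono lip a \<mu>]) simp_all
  also have "\<dots> = (1 - a * \<mu>)
        * expectation (\<lambda>\<omega>. (norm (w \<omega> - zs))\<^sup>2 + (norm (w \<omega> - z \<omega>))\<^sup>2 / 3)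
      + 4 / 3 * a\<^sup>2 * (2 * expectation (\<lambda>\<omega>. (norm (g \<omega> - \<Phi> (z \<omega>)))\<^sup>2)
        + expectation (\<lambda>\<omega>. (norm (g' \<omega> - \<Phi> (z' \<omega>)))\<^sup>2))"
    using sq orth by simp
  also have "\<dots> \<le> (1 - a * \<mu>)
        * expectation (\<lambda>\<omega>. (norm (w \<omega> - zs))\<^sup>2 + (norm (w \<omega> - z \<omega>))\<^sup>2 / 3)
      + 4 / 3 * a\<^sup>2 * (2 * (2 * s) + 2 * s)"
    using noise by (intro add_left_mono mult_left_mono add_mono) auto
  finally show ?thesis
    by (simp add: mult.commute mult.left_commute)
qed

text \<open>With the error written as \<open>q * c\<close>, the number \<open>c\<close> is the fixed
  point of the recursion, so the accumulated error never exceeds \<open>c\<close>. The exponential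
  enters through 1 - q \<le> exp (- q).\<close>

lemma contraction_with_noise:
  fixes E :: "nat \<Rightarrow> real"
  assumes step: "\<And>j. j < m \<Longrightarrow> E (Suc j) \<le> (1 - q) * E j + q * c"
    and q: "0 \<le> q" "q \<le> 1" and c: "0 \<le> c" and E: "0 \<le> E 0"
  shows "E m \<le> exp (- q * real m) * E 0 + c"
proof -
  have "E j \<le> (1 - q) ^ j * E 0 + (1 - (1 - q) ^ j) * c" if "j \<le> m" for j
    using that
  proof (induction j)
    case (Suc j)
    have "E (Suc j) \<le> (1 - q) * E j + q * c"
      using Suc.prems by (intro step) simp
    also have "\<dots> \<le> (1 - q) * ((1 - q) ^ j * E 0 + (1 - (1 - q) ^ j) * c) + q * c"
      using Suc q by (intro add_right_mono mult_left_mono) auto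
    also have "\<dots> = (1 - q) ^ Suc j * E 0 + (1 - (1 - q) ^ Suc j) * c"
      by (simp add: algebra_simps)
    finally show ?case .
  qed simp
  then have "E m \<le> (1 - q) ^ m * E 0 + (1 - (1 - q) ^ m) * c"
    by simp
  also have "\<dots> \<le> exp (- q * real m) * E 0 + 1 * c"
  proof (intro add_mono mult_right_mono)
    have "(1 - q) ^ m \<le> exp (- q) ^ m"
      using q exp_ge_add_one_self[of "- q"] by (intro power_mono) auto
    then show "(1 - q) ^ m \<le> exp (- q * real m)"
      by (simp add: mult.commute flip: exp_of_nat_mult)
  qed (use q c E in auto)
  finally show ?thesis
    by simp
qed

subsection \<open>The past of a sample pair\<close>

lemma sigma_algebra_past_events: "sigma_algebra (space M) (past_events M K n z w i)"
  unfolding past_events_def by (rule sigma_algebra_sigma_sets) auto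

lemma
  assumes "1 \<le> k" "k \<le> K" "j \<le> n k"
  shows measurable_past_z: "point_index n k j \<le> i \<Longrightarrow>
      z k j \<in> borel_measurable (sigma (space M) (past_events M K n z w i))"
    and measurable_past_w: "point_index n k j < i \<Longrightarrow>
      w k j \<in> borel_measurable (sigma (space M) (past_events M K n z w i))"
proof -
  interpret F: sigma_algebra "space M" "past_events M K n z w i"
    by (rule sigma_algebra_past_events)
  have sets_F: "sets (sigma (space M) (past_events M K n z w i)) = past_events M K n z w i"
    using F.space_closed by (simp add: F.sigma_sets_eq)
  show "z k j \<in> borel_measurable (sigma (space M) (past_events M K n z w i))"
    if "point_index n k j \<le> i"
  proof (rule measurableI)
    fix A :: "'b set" assume "A \<in> sets borel"
    then have "z k j -` A \<inter> space M \<in> past_events M K n z w i"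
      using assms that unfolding past_events_def by (intro sigma_sets.Basic) blast
    then show "z k j -` A \<inter> space (sigma (space M) (past_events M K n z w i))
        \<in> sets (sigma (space M) (past_events M K n z w i))"
      unfolding sets_F using F.space_closed by simp
  qed simp
  show "w k j \<in> borel_measurable (sigma (space M) (past_events M K n z w i))"
    if "point_index n k j < i"
  proof (rule measurableI)
    fix A :: "'b set" assume "A \<in> sets borel"
    then have "w k j -` A \<inter> space M \<in> past_events M K n z w i"
      using assms that unfolding past_events_def by (intro sigma_sets.Basic) blast
    then show "w k j -` A \<inter> space (sigma (space M) (past_events M K n z w i))
        \<in> sets (sigma (space M) (past_events M K n z w i))"
      unfolding sets_F using F.space_closed by simp
  qed simp
qed

subsection \<open>The multistage method\<close>

theorem theorem5p2:
  fixes f :: "(real ^ 'm) \<times> (real ^ 'n) \<Rightarrow> real"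
    and \<mu>\<^sub>x \<mu>\<^sub>y L\<^sub>x L\<^sub>y L\<^sub>x\<^sub>y L\<^sub>y\<^sub>x \<mu> L \<kappa> \<sigma> p :: real
    and zs z\<^sub>0 :: "(real ^ 'm) \<times> (real ^ 'n)"
    and M :: "'w measure" and S :: "'s measure" and T :: "'t measure"
    and \<zeta> :: "nat \<Rightarrow> 'w \<Rightarrow> 's" and \<xi> :: "nat \<Rightarrow> 'w \<Rightarrow> 't"
    and Gx :: "(real ^ 'm) \<times> (real ^ 'n) \<Rightarrow> 's \<Rightarrow> real ^ 'm"
    and Gy :: "(real ^ 'm) \<times> (real ^ 'n) \<Rightarrow> 't \<Rightarrow> real ^ 'n"
    and K :: nat and \<alpha> :: "nat \<Rightarrow> real" and n :: "nat \<Rightarrow> nat"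
    and z w :: "nat \<Rightarrow> nat \<Rightarrow> 'w \<Rightarrow> (real ^ 'm) \<times> (real ^ 'n)"
  (* objective *)
  assumes f_C1: "continuously_differentiable f"
    and \<mu>_pos: "\<mu>\<^sub>x > 0" "\<mu>\<^sub>y > 0"
    and f_x: "\<And>y. smooth_fun L\<^sub>x (\<lambda>x. f (x, y)) \<and> strongly_convex \<mu>\<^sub>x (\<lambda>x. f (x, y))"
    and f_y: "\<And>x. smooth_fun L\<^sub>y (\<lambda>y. f (x, y)) \<and> strongly_concave \<mu>\<^sub>y (\<lambda>y. f (x, y))"
    and f_xy: "\<And>x y y'. norm (grad_x f (x, y) - grad_x f (x, y')) \<le> L\<^sub>x\<^sub>y * norm (y - y')"
    and f_yx: "\<And>x x' y. norm (grad_y f (x, y) - grad_y f (x', y)) \<le> L\<^sub>y\<^sub>x * norm (x - x')"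
    and \<mu>_eq: "\<mu> = min \<mu>\<^sub>x \<mu>\<^sub>y"
    and L_eq: "L = Max {L\<^sub>x, L\<^sub>y, L\<^sub>x\<^sub>y, L\<^sub>y\<^sub>x}"
    and \<kappa>_eq: "\<kappa> = L / \<mu>"
    and zs: "saddle_point f zs"
  (* parameters *)
    and p: "p \<ge> 2"
    and \<alpha>_1: "\<alpha> 1 = 1 / (8 * L)"
    and n_1: "n 1 \<ge> 1"
    and \<alpha>_k: "\<And>k. 2 \<le> k \<Longrightarrow> k \<le> K \<Longrightarrow> \<alpha> k = 1 / (L * 2 ^ (k + 3))"
    and n_k: "\<And>k. 2 \<le> k \<Longrightarrow> k \<le> K \<Longrightarrow> n k = nat \<lceil>p * 2 ^ (k + 3) * \<kappa> * ln 2\<rceil>"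
  (* iterates *)
    and z_eq: "z = (\<lambda>k j \<omega>. fst (mogda \<alpha> n (\<lambda>i v. stoch_Phi Gx Gy v (\<zeta> i \<omega>) (\<xi> i \<omega>)) z\<^sub>0 k j))"
    and w_eq: "w = (\<lambda>k j \<omega>. snd (mogda \<alpha> n (\<lambda>i v. stoch_Phi Gx Gy v (\<zeta> i \<omega>) (\<xi> i \<omega>)) z\<^sub>0 k j))"
  (* stochastic oracle *)
    and M: "prob_space M"
    and Gx_meas: "(\<lambda>(v, s). Gx v s) \<in> borel_measurable (borel \<Otimes>\<^sub>M S)"
    and Gy_meas: "(\<lambda>(v, t). Gy v t) \<in> borel_measurable (borel \<Otimes>\<^sub>M T)"
    and samples_meas: "\<And>i. \<zeta> i \<in> measurable M S" "\<And>i. \<xi> i \<in> measurable M T"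
    and indep_samples: "\<And>k j i. 1 \<le> k \<Longrightarrow> k \<le> K \<Longrightarrow> j \<le> n k \<Longrightarrow> i = point_index n k j \<Longrightarrow>
      prob_space.indep_set M
        (sets (vimage_algebra (space M) (\<zeta> i) S)) (sets (vimage_algebra (space M) (\<xi> i) T))"
    and indep_past: "\<And>k j i. 1 \<le> k \<Longrightarrow> k \<le> K \<Longrightarrow> j \<le> n k \<Longrightarrow> i = point_index n k j \<Longrightarrow>
      prob_space.indep_set M
        (sets (vimage_algebra (space M) (\<lambda>\<omega>. (\<zeta> i \<omega>, \<xi> i \<omega>)) (S \<Otimes>\<^sub>M T)))
        (past_events M K n z w i)"
    and unbiased_x: "\<And>k j i. 1 \<le> k \<Longrightarrow> k \<le> K \<Longrightarrow> j \<le> n k \<Longrightarrow> i = point_index n k j \<Longrightarrow>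
      AE \<omega> in M. vec_cond_exp M (vimage_algebra (space M) (z k j) borel)
        (\<lambda>\<omega>. Gx (z k j \<omega>) (\<zeta> i \<omega>)) \<omega> = grad_x f (z k j \<omega>)"
    and unbiased_y: "\<And>k j i. 1 \<le> k \<Longrightarrow> k \<le> K \<Longrightarrow> j \<le> n k \<Longrightarrow> i = point_index n k j \<Longrightarrow>
      AE \<omega> in M. vec_cond_exp M (vimage_algebra (space M) (z k j) borel)
        (\<lambda>\<omega>. Gy (z k j \<omega>) (\<xi> i \<omega>)) \<omega> = grad_y f (z k j \<omega>)"
    and variance_x: "\<And>k j i. 1 \<le> k \<Longrightarrow> k \<le> K \<Longrightarrow> j \<le> n k \<Longrightarrow> i = point_index n k j \<Longrightarrow>
      AE \<omega> in M. nn_cond_exp M (vimage_algebra (space M) (z k j) borel)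
        (\<lambda>\<omega>. ennreal ((norm (Gx (z k j \<omega>) (\<zeta> i \<omega>) - grad_x f (z k j \<omega>)))\<^sup>2)) \<omega> \<le> ennreal (\<sigma>\<^sup>2)"
    and variance_y: "\<And>k j i. 1 \<le> k \<Longrightarrow> k \<le> K \<Longrightarrow> j \<le> n k \<Longrightarrow> i = point_index n k j \<Longrightarrow>
      AE \<omega> in M. nn_cond_exp M (vimage_algebra (space M) (z k j) borel)
        (\<lambda>\<omega>. ennreal ((norm (Gy (z k j \<omega>) (\<xi> i \<omega>) - grad_y f (z k j \<omega>)))\<^sup>2)) \<omega> \<le> ennreal (\<sigma>\<^sup>2)"
  shows "\<forall>k. 1 \<le> k \<and> k \<le> K \<longrightarrow>
    integrable M (\<lambda>\<omega>. (norm (w k (n k) \<omega> - zs))\<^sup>2) \<and>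
    prob_space.expectation M (\<lambda>\<omega>. (norm (w k (n k) \<omega> - zs))\<^sup>2)
      \<le> exp (- real (n 1) / (8 * \<kappa>)) / 2 powr (p * (real k - 1)) * (norm (z\<^sub>0 - zs))\<^sup>2
        + \<sigma>\<^sup>2 / (2 ^ (k - 1) * L * \<mu>)"
proof -
  interpret prob_space M
    by (rule M)
  note [measurable] = samples_meas
  define \<Phi> where "\<Phi> = saddle_op f"
  define g where "g k j \<omega> = stoch_Phi Gx Gy (z k j \<omega>)
    (\<zeta> (point_index n k j) \<omega>) (\<xi> (point_index n k j) \<omega>)" for k j \<omega>
  define past where "past k j = past_events M K n z w (point_index n k j)" for k j

  \<comment> \<open>Constants and regularity of the saddle operator\<close>
  have L_ge: "L\<^sub>x \<le> L" "L\<^sub>y \<le> L" "L\<^sub>x\<^sub>y \<le> L" "L\<^sub>y\<^sub>x \<le> L"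
    unfolding L_eq by simp_all
  have \<mu>: "0 < \<mu>" "\<mu> \<le> L"
    using \<mu>_pos L_ge(1) strong_convexity_le_smoothness[of \<mu>\<^sub>x _ L\<^sub>x] f_x
    by (auto simp: \<mu>_eq min_le_iff_disj intro: order_trans)
  then have L: "0 < L"
    by linarith
  have lip: "norm (\<Phi> u - \<Phi> v) \<le> 2 * L * norm (u - v)" for u v
    unfolding \<Phi>_def
  proof (rule saddle_op_lipschitz)
    show "smooth_fun L (\<lambda>x. f (x, y))" for y
      using f_x L_ge(1) by (rule smooth_fun_mono[OF conjunct1])
    show "smooth_fun L (\<lambda>y. f (x, y))" for x
      using f_y L_ge(2) by (rule smooth_fun_mono[OF conjunct1])
    show "norm (grad_x f (x, y) - grad_x f (x, y')) \<le> L * norm (y - y')" for x y y'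
      using f_xy mult_right_mono[OF L_ge(3) norm_ge_zero] by (rule order_trans)
    show "norm (grad_y f (x, y) - grad_y f (x', y)) \<le> L * norm (x - x')" for x x' y
      using f_yx mult_right_mono[OF L_ge(4) norm_ge_zero] by (rule order_trans)
  qed
  have mono: "\<mu> * (norm (u - zs))\<^sup>2 \<le> \<Phi> u \<bullet> (u - zs)" for u
    using saddle_op_strongly_monotone[OF f_C1, of \<mu>\<^sub>x \<mu>\<^sub>y u zs] f_x f_y
      saddle_op_eq_zero[OF f_C1 zs] by (simp add: \<Phi>_def \<mu>_eq)
  have \<Phi>_meas [measurable]: "\<Phi> \<in> borel_measurable borel"
    using lip by (rule borel_measurable_lipschitz)
  \<comment> \<open>As components of \<Phi> up to sign, the partial gradients inherit its Lipschitz
    bound and its measurability.\<close>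
  have grad_eq: "grad_x f = (\<lambda>u. fst (\<Phi> u))" "grad_y f = (\<lambda>u. - snd (\<Phi> u))"
    by (simp_all add: \<Phi>_def saddle_op_def fun_eq_iff)
  have \<Phi>_lip_comp: "norm (grad_x f u - grad_x f v) \<le> 2 * L * norm (u - v)"
    "norm (grad_y f u - grad_y f v) \<le> 2 * L * norm (u - v)" for u v
    using lip[of u v] norm_fst_le[of "fst (\<Phi> u - \<Phi> v)" "snd (\<Phi> u - \<Phi> v)"]
      norm_snd_le[of "snd (\<Phi> u - \<Phi> v)" "fst (\<Phi> u - \<Phi> v)"]
    unfolding grad_eq prod.collapse
    by (simp_all add: norm_minus_commute[of "snd (\<Phi> v)"])
  note [measurable] = borel_measurable_lipschitz[OF \<Phi>_lip_comp(1)]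
    borel_measurable_lipschitz[OF \<Phi>_lip_comp(2)]

  \<comment> \<open>Recursion of the iterates\<close>
  have z_start: "z 1 0 = (\<lambda>\<omega>. z\<^sub>0)" "w 1 0 = (\<lambda>\<omega>. z\<^sub>0)"
    by (simp_all add: z_eq w_eq)
  have stage_start: "z (Suc k) 0 = z k (n k)" "w (Suc k) 0 = w k (n k)" for k
    by (simp_all add: z_eq w_eq)
  have rec: "z k (Suc j) \<omega> = w k j \<omega> - \<alpha> k *\<^sub>R g k j \<omega>"
    "w k (Suc j) \<omega> = w k j \<omega> - \<alpha> k *\<^sub>R g k (Suc j) \<omega>" if "1 \<le> k" for k j \<omega>
    using that by (cases k; simp add: z_eq w_eq g_def Let_def split_beta)+

  \<comment> \<open>Independence of the past is stated for the sample pair, so each estimate is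
    regarded as a function of the whole pair.\<close>
  have Gx_joint: "(\<lambda>(v, s, t). Gx v s) \<in> borel_measurable (borel \<Otimes>\<^sub>M (S \<Otimes>\<^sub>M T))"
  proof -
    have "(\<lambda>q. (fst q, fst (snd q))) \<in> borel \<Otimes>\<^sub>M (S \<Otimes>\<^sub>M T) \<rightarrow>\<^sub>M borel \<Otimes>\<^sub>M S"
      by measurable
    from measurable_compose[OF this Gx_meas] show ?thesis
      by (simp add: split_beta')
  qed
  have Gy_joint: "(\<lambda>(v, s, t). Gy v t) \<in> borel_measurable (borel \<Otimes>\<^sub>M (S \<Otimes>\<^sub>M T))"
  proof -
    have "(\<lambda>q. (fst q, snd (snd q))) \<in> borel \<Otimes>\<^sub>M (S \<Otimes>\<^sub>M T) \<rightarrow>\<^sub>M borel \<Otimes>\<^sub>M T"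
      by measurable
    from measurable_compose[OF this Gy_meas] show ?thesis
      by (simp add: split_beta')
  qed

  \<comment> \<open>Oracle noise and second moments\<close>
  define ex where "ex k j \<omega> = Gx (z k j \<omega>) (\<zeta> (point_index n k j) \<omega>) - grad_x f (z k j \<omega>)"
    for k j \<omega>
  define ey where "ey k j \<omega> = Gy (z k j \<omega>) (\<xi> (point_index n k j) \<omega>) - grad_y f (z k j \<omega>)"
    for k j \<omega>
  have noise_eq: "g k j \<omega> - \<Phi> (z k j \<omega>) = (ex k j \<omega>, - ey k j \<omega>)" for k j \<omega>
    by (simp add: g_def stoch_Phi_def ex_def ey_def \<Phi>_def saddle_op_def)

  have noise: "sq_integrable M (ex k j)" "sq_integrable M (ey k j)"
    "expectation (\<lambda>\<omega>. (norm (g k j \<omega> - \<Phi> (z k j \<omega>)))\<^sup>2) \<le> 2 * \<sigma>\<^sup>2"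
    if kj: "1 \<le> k" "k \<le> K" "j \<le> n k" and z_sq: "sq_integrable M (z k j)" for k j
  proof -
    note [measurable] = sq_integrableD(1)[OF z_sq]
    have "(\<lambda>\<omega>. (z k j \<omega>, \<zeta> (point_index n k j) \<omega>)) \<in> M \<rightarrow>\<^sub>M borel \<Otimes>\<^sub>M S"
      by measurable
    from measurable_compose[OF this Gx_meas] have ex [measurable]: "ex k j \<in> borel_measurable M"
      unfolding ex_def by simp
    have "(\<lambda>\<omega>. (z k j \<omega>, \<xi> (point_index n k j) \<omega>)) \<in> M \<rightarrow>\<^sub>M borel \<Otimes>\<^sub>M T"
      by measurable
    from measurable_compose[OF this Gy_meas] have ey [measurable]: "ey k j \<in> borel_measurable M"
      unfolding ey_def by simp
    have sub: "subalgebra M (vimage_algebra (space M) (z k j) borel)"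
      unfolding subalgebra_def by (auto simp: sets_vimage_algebra2)
    note x = sq_integrable_of_nn_cond_exp_le[OF sub ex _ zero_le_power2[of \<sigma>]]
    note y = sq_integrable_of_nn_cond_exp_le[OF sub ey _ zero_le_power2[of \<sigma>]]
    show ex_sq: "sq_integrable M (ex k j)" and ey_sq: "sq_integrable M (ey k j)"
      using x(1) y(1) variance_x[OF kj refl] variance_y[OF kj refl]
      unfolding ex_def ey_def by blast+
    have "expectation (\<lambda>\<omega>. (norm (ex k j \<omega>))\<^sup>2) \<le> \<sigma>\<^sup>2"
      "expectation (\<lambda>\<omega>. (norm (ey k j \<omega>))\<^sup>2) \<le> \<sigma>\<^sup>2"
      using x(2) y(2) variance_x[OF kj refl] variance_y[OF kj refl]
      unfolding ex_def ey_def by blast+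
    then show "expectation (\<lambda>\<omega>. (norm (g k j \<omega> - \<Phi> (z k j \<omega>)))\<^sup>2) \<le> 2 * \<sigma>\<^sup>2"
      using sq_integrableD(2)[OF ex_sq] sq_integrableD(2)[OF ey_sq]
      by (simp add: noise_eq norm_Pair)
  qed

  have g_sq: "sq_integrable M (g k j)"
    if kj: "1 \<le> k" "k \<le> K" "j \<le> n k" and z_sq: "sq_integrable M (z k j)" for k j
  proof -
    \<comment> \<open>The stochastic gradient is its noise plus
      \<open>\<Phi> (z k j \<omega>)\<close>, and both are square-integrable.\<close>
    have "sq_integrable M (\<lambda>\<omega>. (ex k j \<omega>, - ey k j \<omega>))"
      using noise(1,2)[OF that] sq_integrable_scaleR[of M "ey k j" "-1"]
      by (intro sq_integrable_Pair) auto
    from sq_integrable_add[OF this sq_integrable_lipschitz[OF z_sq lip]] show ?thesis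
      by (simp flip: noise_eq)
  qed

  \<comment> \<open>Within a step the order matters: the new \<open>z\<close> comes first, since
    square-integrability of the gradient at that point depends on it, and only then the new
    \<open>w\<close>.\<close>
  have sq: "sq_integrable M (z k j) \<and> sq_integrable M (w k j)"
    if "1 \<le> k" "k \<le> K" "j \<le> n k" for k j
    using that
  proof (induction k arbitrary: j rule: nat_induct_at_least)
    case base
    then show ?case
    proof (induction j)
      case 0
      show ?case
        unfolding z_start by (simp add: sq_integrable_const)
    next
      case (Suc j)
      then have z_sq: "sq_integrable M (z 1 (Suc j))"
        using g_sq[of 1 j] unfolding rec(1)[OF order_refl, abs_def]
        by (auto intro!: sq_integrable_diff sq_integrable_scaleR)
      with Suc show ?case
        using g_sq[of 1 "Suc j"] unfolding rec(2)[OF order_refl, abs_def]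
        by (auto intro!: sq_integrable_diff sq_integrable_scaleR)
    qed
  next
    case (Suc k)
    from Suc.prems show ?case
    proof (induction j)
      case 0
      show ?case
        unfolding stage_start using Suc.IH Suc.prems by simp
    next
      case (Suc j)
      have k: "1 \<le> Suc k"
        by simp
      have z_sq: "sq_integrable M (z (Suc k) (Suc j))"
        using Suc g_sq[of "Suc k" j] unfolding rec(1)[OF k, abs_def]
        by (auto intro!: sq_integrable_diff sq_integrable_scaleR)
      with Suc show ?case
        using g_sq[of "Suc k" "Suc j"] unfolding rec(2)[OF k, abs_def]
        by (auto intro!: sq_integrable_diff sq_integrable_scaleR)
    qed
  qed

  \<comment> \<open>Orthogonality of the noise to the past\<close>
  have orth: "expectation (\<lambda>\<omega>. (g k j \<omega> - \<Phi> (z k j \<omega>)) \<bullet> v \<omega>) = 0"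
    if kj: "1 \<le> k" "k \<le> K" "j \<le> n k" and v: "v \<in> borel_measurable (sigma (space M) (past k j))"
      and v_sq: "sq_integrable M v" for k j and v :: "'w \<Rightarrow> (real ^ 'm) \<times> (real ^ 'n)"
  proof -
    let ?i = "point_index n k j"
    have z_sq: "sq_integrable M (z k j)"
      using sq[OF kj] ..
    have X: "(\<lambda>\<omega>. (\<zeta> ?i \<omega>, \<xi> ?i \<omega>)) \<in> M \<rightarrow>\<^sub>M S \<Otimes>\<^sub>M T"
      by measurable
    have F: "sigma_algebra (space M) (past k j)"
      unfolding past_def by (rule sigma_algebra_past_events)
    have z_past: "z k j \<in> borel_measurable (sigma (space M) (past k j))"
      unfolding past_def using kj by (rule measurable_past_z) simp
    note indep = indep_past[OF kj refl, folded past_def]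
    have vx_sq: "sq_integrable M (\<lambda>\<omega>. fst (v \<omega>))" and vy_sq: "sq_integrable M (\<lambda>\<omega>. snd (v \<omega>))"
      using v_sq by (rule sq_integrable_fst, rule sq_integrable_snd)
    have gx_sq: "sq_integrable M (\<lambda>\<omega>. grad_x f (z k j \<omega>))"
      and gy_sq: "sq_integrable M (\<lambda>\<omega>. grad_y f (z k j \<omega>))"
      using sq_integrable_lipschitz[OF z_sq \<Phi>_lip_comp(1)]
        sq_integrable_lipschitz[OF z_sq \<Phi>_lip_comp(2)] .
    have Gx_sq: "sq_integrable M (\<lambda>\<omega>. Gx (z k j \<omega>) (\<zeta> ?i \<omega>))"
      using sq_integrable_add[OF noise(1)[OF kj z_sq] gx_sq] by (simp add: ex_def)
    have Gy_sq: "sq_integrable M (\<lambda>\<omega>. Gy (z k j \<omega>) (\<xi> ?i \<omega>))"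
      using sq_integrable_add[OF noise(2)[OF kj z_sq] gy_sq] by (simp add: ey_def)
    have "expectation (\<lambda>\<omega>. ex k j \<omega> \<bullet> fst (v \<omega>)) = 0"
      using expectation_inner_indep_past[OF X F indep z_past _ Gx_joint, where
          v = "\<lambda>\<omega>. fst (v \<omega>)" and \<phi> = "grad_x f"] borel_measurable_fst[OF v]
        Gx_sq gx_sq vx_sq unbiased_x[OF kj refl]
      by (simp add: ex_def)
    moreover have "expectation (\<lambda>\<omega>. ey k j \<omega> \<bullet> snd (v \<omega>)) = 0"
      using expectation_inner_indep_past[OF X F indep z_past _ Gy_joint, where
          v = "\<lambda>\<omega>. snd (v \<omega>)" and \<phi> = "grad_y f"] borel_measurable_snd[OF v]
        Gy_sq gy_sq vy_sq unbiased_y[OF kj refl]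
      by (simp add: ey_def)
    ultimately show ?thesis
      using integrable_inner_sq_integrable[OF noise(1)[OF kj z_sq] vx_sq]
        integrable_inner_sq_integrable[OF noise(2)[OF kj z_sq] vy_sq]
      by (simp add: noise_eq inner_prod_def)
  qed

  \<comment> \<open>Lyapunov function over one step and over one stage\<close>
  define E where
    "E k j = expectation (\<lambda>\<omega>. (norm (w k j \<omega> - zs))\<^sup>2 + (norm (w k j \<omega> - z k j \<omega>))\<^sup>2 / 3)" for k j
  have E_nonneg: "0 \<le> E k j" for k j
    unfolding E_def by (intro integral_nonneg_AE) simp

  have step: "E k (Suc j) \<le> (1 - \<alpha> k * \<mu>) * E k j + 8 * (\<alpha> k)\<^sup>2 * \<sigma>\<^sup>2"
    if k: "1 \<le> k" "k \<le> K" and j: "j < n k" and a: "0 < \<alpha> k" "\<alpha> k * L \<le> 1 / 8" for k j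
    unfolding E_def
  proof (rule optimistic_step_expectation[where \<Phi> = \<Phi> and g = "g k j" and g' = "g k (Suc j)",
        OF rec(1)[OF k(1)] rec(2)[OF k(1)] mono lip a \<mu>])
    have j': "j \<le> n k" "Suc j \<le> n k"
      using j by simp_all
    note sq_j = sq[OF k j'(1)] and sq_Suc = sq[OF k j'(2)]
    show "sq_integrable M (z k j)" "sq_integrable M (w k j)"
      using sq_j by simp_all
    show g_j: "sq_integrable M (g k j)" and "sq_integrable M (g k (Suc j))"
      using g_sq[OF k j'(1)] g_sq[OF k j'(2)] sq_j sq_Suc by simp_all
    show "expectation (\<lambda>\<omega>. (norm (g k j \<omega> - \<Phi> (z k j \<omega>)))\<^sup>2) \<le> 2 * \<sigma>\<^sup>2"
      "expectation (\<lambda>\<omega>. (norm (g k (Suc j) \<omega> - \<Phi> (z k (Suc j) \<omega>)))\<^sup>2) \<le> 2 * \<sigma>\<^sup>2"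
      using noise(3)[OF k j'(1)] noise(3)[OF k j'(2)] sq_j sq_Suc by simp_all
    let ?F = "sigma (space M) (past k (Suc j))"
    have z_past [measurable]: "z k (Suc j) \<in> borel_measurable ?F"
      unfolding past_def using k j'(2) by (rule measurable_past_z) simp
    have w_past [measurable]: "w k j \<in> borel_measurable ?F"
      unfolding past_def using k j'(1) by (rule measurable_past_w) (simp add: point_index_def)
    \<comment> \<open>The past is generated by iterates, not by samples. The earlier gradient still
      belongs to it, because a positive stepsize allows it to be recovered from \<open>w k j\<close>
      and \<open>z k (Suc j)\<close>.\<close>
    have "g k j = (\<lambda>\<omega>. (1 / \<alpha> k) *\<^sub>R (w k j \<omega> - z k (Suc j) \<omega>))"
      using a by (simp add: rec(1)[OF k(1)])
    then have [measurable]: "g k j \<in> borel_measurable ?F"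
      by simp
    show "expectation (\<lambda>\<omega>. (g k (Suc j) \<omega> - \<Phi> (z k (Suc j) \<omega>)) \<bullet> (z k (Suc j) \<omega> - zs)) = 0"
      using sq_Suc by (intro orth k j' sq_integrable_diff sq_integrable_const) simp_all
    show "expectation (\<lambda>\<omega>. (g k (Suc j) \<omega> - \<Phi> (z k (Suc j) \<omega>))
        \<bullet> (\<Phi> (z k (Suc j) \<omega>) - g k j \<omega>)) = 0"
      using sq_Suc g_j
      by (intro orth k j' sq_integrable_diff sq_integrable_lipschitz[OF _ lip]) simp_all
  qed

  have stage: "E k (n k) \<le> exp (- (\<alpha> k * \<mu>) * real (n k)) * E k 0 + 8 * \<alpha> k * \<sigma>\<^sup>2 / \<mu>"
    if k: "1 \<le> k" "k \<le> K" and a: "0 < \<alpha> k" "\<alpha> k * L \<le> 1 / 8" for k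
  proof (rule contraction_with_noise)
    \<comment> \<open>The step error is written as the contraction rate times a constant, which is
      the form \<open>contraction_with_noise\<close> expects.\<close>
    show "E k (Suc j) \<le> (1 - \<alpha> k * \<mu>) * E k j + \<alpha> k * \<mu> * (8 * \<alpha> k * \<sigma>\<^sup>2 / \<mu>)" if "j < n k" for j
      using step[OF k that a] \<mu> by (simp add: power2_eq_square)
    have "\<alpha> k * \<mu> \<le> \<alpha> k * L"
      using a \<mu> by simp
    then show "\<alpha> k * \<mu> \<le> 1"
      using a by linarith
  qed (use a \<mu> E_nonneg in auto)

  \<comment> \<open>Induction over the stages\<close>
  have bound: "E k (n k)
      \<le> exp (- real (n 1) / (8 * \<kappa>)) / 2 powr (p * (real k - 1)) * (norm (z\<^sub>0 - zs))\<^sup>2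
      + \<sigma>\<^sup>2 / (2 ^ (k - 1) * L * \<mu>)" if "1 \<le> k" "k \<le> K" for k
    using that
  proof (induction k rule: nat_induct_at_least)
    case base
    \<comment> \<open>Initially \<open>w\<close> and \<open>z\<close> coincide, so the Lyapunov
      function starts at the squared distance itself; the first stepsize turns the error into
      \<open>\<sigma>\<^sup>2 / (L * \<mu>)\<close>.\<close>
    have "E 1 (n 1) \<le> exp (- (\<alpha> 1 * \<mu>) * real (n 1)) * E 1 0 + 8 * \<alpha> 1 * \<sigma>\<^sup>2 / \<mu>"
      using base L by (intro stage) (simp_all add: \<alpha>_1[simplified])
    moreover have "E 1 0 = (norm (z\<^sub>0 - zs))\<^sup>2"
      unfolding E_def z_start by (simp add: prob_space)
    moreover have "- (\<alpha> 1 * \<mu>) * real (n 1) = - real (n 1) / (8 * \<kappa>)"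
      by (simp add: \<alpha>_1[simplified] \<kappa>_eq)
    moreover have "8 * \<alpha> 1 * \<sigma>\<^sup>2 / \<mu> = \<sigma>\<^sup>2 / (L * \<mu>)"
      by (simp add: \<alpha>_1[simplified])
    ultimately show ?case
      by simp
  next
    case (Suc k)
    let ?A = "exp (- real (n 1) / (8 * \<kappa>)) / 2 powr (p * (real k - 1)) * (norm (z\<^sub>0 - zs))\<^sup>2"
    have k: "2 \<le> Suc k" "1 \<le> Suc k"
      using Suc.hyps by simp_all
    have \<alpha>: "\<alpha> (Suc k) = 1 / (L * 2 ^ (Suc k + 3))"
      using k(1) Suc.prems by (rule \<alpha>_k)
    \<comment> \<open>The stage length is chosen so that stepsize times \<mu> times length is at
      least \<open>p * ln 2\<close>; the stage thus contracts by
      \<open>2 powr (- p)\<close>.\<close>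
    have "p * 2 ^ (Suc k + 3) * \<kappa> * ln 2 \<le> real (n (Suc k))"
      unfolding n_k[OF k(1) Suc.prems] by (rule real_nat_ceiling_ge)
    then have "\<alpha> (Suc k) * \<mu> * (p * 2 ^ (Suc k + 3) * \<kappa> * ln 2) \<le> \<alpha> (Suc k) * \<mu> * real (n (Suc k))"
      using L \<mu> by (intro mult_left_mono) (simp_all add: \<alpha>)
    moreover have "\<alpha> (Suc k) * \<mu> * (p * 2 ^ (Suc k + 3) * \<kappa> * ln 2) = p * ln 2"
      using L \<mu> by (simp add: \<alpha> \<kappa>_eq)
    ultimately have "p * ln 2 \<le> \<alpha> (Suc k) * \<mu> * real (n (Suc k))"
      by (simp only:)
    then have rate: "exp (- (\<alpha> (Suc k) * \<mu>) * real (n (Suc k))) \<le> 2 powr (- p)"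
      by (simp add: powr_def)
    have "2 powr (- p) \<le> 2 powr (- 2 :: real)"
      using p by (intro powr_mono) auto
    then have quarter: "2 powr (- p) \<le> 1 / 4"
      by (simp add: powr_minus powr_numeral)
    have "1 / (2 ^ (Suc k + 3) :: real) \<le> 1 / 2 ^ 3"
      by (intro divide_left_mono power_increasing) auto
    then have "\<alpha> (Suc k) * L \<le> 1 / 8"
      using L by (simp add: \<alpha>)
    moreover have "0 < \<alpha> (Suc k)"
      using L by (simp add: \<alpha>)
    ultimately have "E (Suc k) (n (Suc k))
        \<le> exp (- (\<alpha> (Suc k) * \<mu>) * real (n (Suc k))) * E (Suc k) 0 + 8 * \<alpha> (Suc k) * \<sigma>\<^sup>2 / \<mu>"
      by (intro stage[OF k(2) Suc.prems])
    also have "E (Suc k) 0 = E k (n k)"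
      unfolding E_def stage_start ..
    also have "exp (- (\<alpha> (Suc k) * \<mu>) * real (n (Suc k))) * E k (n k)
        \<le> 2 powr (- p) * (?A + \<sigma>\<^sup>2 / (2 ^ (k - 1) * L * \<mu>))"
      using rate Suc.IH Suc.prems E_nonneg by (intro mult_mono) auto
    \<comment> \<open>Only the noise part is relaxed to the factor 1/4; the initial distance keeps
      the exact factor needed for the claimed rate.\<close>
    also have "\<dots> \<le> 2 powr (- p) * ?A + 1 / 4 * (\<sigma>\<^sup>2 / (2 ^ (k - 1) * L * \<mu>))"
      unfolding distrib_left using quarter L \<mu> by (intro add_left_mono mult_right_mono) auto
    also have "2 powr (- p) * ?A
        = exp (- real (n 1) / (8 * \<kappa>)) / 2 powr (p * (real (Suc k) - 1)) * (norm (z\<^sub>0 - zs))\<^sup>2"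
    proof -
      have "p * (real (Suc k) - 1) = p + p * (real k - 1)"
        by (simp add: algebra_simps)
      then have "2 powr (p * (real (Suc k) - 1)) = 2 powr p * 2 powr (p * (real k - 1))"
        by (simp only: powr_add)
      then show ?thesis
        by (simp only: powr_minus divide_inverse inverse_mult_distrib mult_ac)
    qed
    \<comment> \<open>The inherited noise and the noise of the new stage are equal, each half of the
      target, whose exponent is \<open>Suc k - 1 = k\<close>. Here k \<ge> 1 makes
      \<open>k - 1\<close> a true subtraction.\<close>
    also have "1 / 4 * (\<sigma>\<^sup>2 / (2 ^ (k - 1) * L * \<mu>)) = \<sigma>\<^sup>2 / (2 * 2 ^ k * L * \<mu>)"
      using Suc.hyps by (cases k) simp_all
    also have "8 * \<alpha> (Suc k) * \<sigma>\<^sup>2 / \<mu> = \<sigma>\<^sup>2 / (2 * 2 ^ k * L * \<mu>)"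
      by (simp add: \<alpha> power_add)
    finally show ?case
      by (simp add: mult.commute mult.left_commute)
  qed

  show ?thesis
  proof (intro allI impI conjI)
    fix k assume "1 \<le> k \<and> k \<le> K"
    then have k: "1 \<le> k" "k \<le> K"
      by simp_all
    note sq_k = sq[OF k order_refl]
    show V: "integrable M (\<lambda>\<omega>. (norm (w k (n k) \<omega> - zs))\<^sup>2)"
      using sq_k by (intro sq_integrableD(2) sq_integrable_diff sq_integrable_const) simp
    have "integrable M (\<lambda>\<omega>. (norm (w k (n k) \<omega> - z k (n k) \<omega>))\<^sup>2)"
      using sq_k by (intro sq_integrableD(2) sq_integrable_diff) simp_all
    with V have "expectation (\<lambda>\<omega>. (norm (w k (n k) \<omega> - zs))\<^sup>2) \<le> E k (n k)"
      unfolding E_def by (intro integral_mono) auto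
    also note bound[OF k]
    finally show "expectation (\<lambda>\<omega>. (norm (w k (n k) \<omega> - zs))\<^sup>2)
      \<le> exp (- real (n 1) / (8 * \<kappa>)) / 2 powr (p * (real k - 1)) * (norm (z\<^sub>0 - zs))\<^sup>2
        + \<sigma>\<^sup>2 / (2 ^ (k - 1) * L * \<mu>)" .
  qed
qed

end
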